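(* Let $J$ and $N$ be finite nilpotent groups, and suppose $J$ acts on $N$ via automorphisms. Let $\mathcal{D}$ denote the set of primes dividing both $|J|$ and $|N|$, and for each prime $p$ let $J_p$ be the Sylow $p$-subgroup of $J$ and $J'_p$ the Hall $p'$-subgroup of $J$. Then the map sending the class of a crossed homomorphism $\varphi : J \to N$ to the tuple of classes of the restrictions $(\varphi|_{J_p})_{p \in \mathcal{D}}$ induces an isomorphism of pointed sets $$H^1(J, N) \cong \prod_{p \in \mathcal{D}} H^1(J_p, N)^{J'_p}.$$
   Context: All groups are finite. The action of $J$ on $N$ is written $n \mapsto n^{j}$, where in the semidirect product $N \rtimes J$ one has $g^\gamma = \gamma^{-1} g \gamma$; thus it is a right action. For a group $K$ acting on $N$ via automorphisms in this way, $Z^1(K,N)$ is the set of crossed homomorphisms, i.e. maps $\varphi : K \to N$ with $\varphi(kk') = \varphi(k)\,\varphi(k')^{k^{-1}}$ for all $k,k' \in K$. Two crossed homomorphisms $\varphi,\varphi'$ are cohomologous, written $\varphi \sim \varphi'$, if there exists $n \in N$ with $\varphi'(k) = n^{-1}\varphi(k)\,n^{k^{-1}}$ for all $k \in K$. The first cohomology $H^1(K,N)$ is the pointed set $Z^1(K,N)/\!\sim$, whose distinguished point is the class of the map sending every element of $K$ to the identity of $N$. An isomorphism of pointed sets is a bijection preserving distinguished points; a product of pointed sets has as distinguished point the tuple of distinguished points. Since $J$ is nilpotent, $J = J_p \times J'_p$. For $\varphi \in Z^1(J_p,N)$ and $j \in J$, define $\varphi^j(x) = \varphi(x^{j^{-1}})^j$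 for $x \in J_p$; this induces an action of $J$ on $H^1(J_p,N)$. The set $H^1(J_p,N)^{J'_p}$ consists of the classes in $H^1(J_p,N)$ fixed by $J'_p$ under this action, i.e. the classes of those $\varphi$ for which $\varphi^{j} \sim \varphi$ for all $j \in J'_p$. (For $j \in J'_p$, $\varphi^j(x) = \varphi(x)^j$.) *)

theory Defs
  imports "HOL-Algebra.Algebra"
begin

definition commutator_subgroup :: "('a, 'x) monoid_scheme \<Rightarrow> 'a set \<Rightarrow> 'a set \<Rightarrow> 'a set" where
  "commutator_subgroup G H K =
     generate G (\<Union>h\<in>H. \<Union>k\<in>K. {h \<otimes>\<^bsub>G\<^esub> k \<otimes>\<^bsub>G\<^esub> inv\<^bsub>G\<^esub> h \<otimes>\<^bsub>G\<^esub> inv\<^bsub>G\<^esub> k})"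

primrec lower_central_series :: "('a, 'x) monoid_scheme \<Rightarrow> nat \<Rightarrow> 'a set" where
  "lower_central_series G 0 = carrier G"
| "lower_central_series G (Suc n) = commutator_subgroup G (lower_central_series G n) (carrier G)"

definition nilpotent_group :: "('a, 'x) monoid_scheme \<Rightarrow> bool" where
  "nilpotent_group G \<longleftrightarrow> group G \<and> (\<exists>n. lower_central_series G n = {\<one>\<^bsub>G\<^esub>})"

definition is_sylow_subgroup :: "('a, 'x) monoid_scheme \<Rightarrow> nat \<Rightarrow> 'a set \<Rightarrow> bool" where
  "is_sylow_subgroup G p P \<longleftrightarrow> subgroup P G \<and> card P = p ^ multiplicity p (order G)"

definition is_hall_complement_subgroup :: "('a, 'x) monoid_scheme \<Rightarrow> nat \<Rightarrow> 'a set \<Rightarrow> bool" where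
  "is_hall_complement_subgroup G p Q \<longleftrightarrow>
     subgroup Q G \<and> \<not> p dvd card Q \<and> (\<exists>k. card (rcosets\<^bsub>G\<^esub> Q) = p ^ k)"

text \<open>In a finite nilpotent group the Sylow \<open>p\<close>-subgroup and the Hall \<open>p'\<close>-subgroup exist and
  are unique; the two descriptions below are meant for such groups only.\<close>

definition sylow_subgroup :: "('a, 'x) monoid_scheme \<Rightarrow> nat \<Rightarrow> 'a set" where
  "sylow_subgroup G p = (THE P. is_sylow_subgroup G p P)"

definition hall_complement_subgroup :: "('a, 'x) monoid_scheme \<Rightarrow> nat \<Rightarrow> 'a set" where
  "hall_complement_subgroup G p = (THE Q. is_hall_complement_subgroup G p Q)"

text \<open>Right actions by automorphisms: \<open>act j n\<close> stands for \<open>n^j\<close>, so that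
  \<open>n^(j k) = (n^j)^k\<close> becomes \<open>act (j \<otimes> k) n = act k (act j n)\<close>.\<close>

definition acts_by_automorphisms ::
  "('j, 'x) monoid_scheme \<Rightarrow> ('n, 'y) monoid_scheme \<Rightarrow> ('j \<Rightarrow> 'n \<Rightarrow> 'n) \<Rightarrow> bool" where
  "acts_by_automorphisms J N act \<longleftrightarrow>
     (\<forall>j\<in>carrier J. act j \<in> iso N N) \<and>
     (\<forall>n\<in>carrier N. act \<one>\<^bsub>J\<^esub> n = n) \<and>
     (\<forall>j\<in>carrier J. \<forall>k\<in>carrier J. \<forall>n\<in>carrier N. act (j \<otimes>\<^bsub>J\<^esub> k) n = act k (act j n))"

definition crossed_homs ::
  "('k, 'x) monoid_scheme \<Rightarrow> ('n, 'y) monoid_scheme \<Rightarrow> ('k \<Rightarrow> 'n \<Rightarrow> 'n) \<Rightarrow> ('k \<Rightarrow> 'n) set" where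
  "crossed_homs K N act =
     {\<phi> \<in> carrier K \<rightarrow>\<^sub>E carrier N. \<forall>k\<in>carrier K. \<forall>k'\<in>carrier K.
        \<phi> (k \<otimes>\<^bsub>K\<^esub> k') = \<phi> k \<otimes>\<^bsub>N\<^esub> act (inv\<^bsub>K\<^esub> k) (\<phi> k')}"

definition cohomologous ::
  "('k, 'x) monoid_scheme \<Rightarrow> ('n, 'y) monoid_scheme \<Rightarrow> ('k \<Rightarrow> 'n \<Rightarrow> 'n) \<Rightarrow> (('k \<Rightarrow> 'n) \<times> ('k \<Rightarrow> 'n)) set"
  where
  "cohomologous K N act =
     {(\<phi>, \<phi>'). \<phi> \<in> crossed_homs K N act \<and> \<phi>' \<in> crossed_homs K N act \<and>
        (\<exists>n\<in>carrier N. \<forall>k\<in>carrier K.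
           \<phi>' k = inv\<^bsub>N\<^esub> n \<otimes>\<^bsub>N\<^esub> \<phi> k \<otimes>\<^bsub>N\<^esub> act (inv\<^bsub>K\<^esub> k) n)}"

definition cohom_class ::
  "('k, 'x) monoid_scheme \<Rightarrow> ('n, 'y) monoid_scheme \<Rightarrow> ('k \<Rightarrow> 'n \<Rightarrow> 'n) \<Rightarrow> ('k \<Rightarrow> 'n) \<Rightarrow> ('k \<Rightarrow> 'n) set"
  where
  "cohom_class K N act \<phi> = cohomologous K N act `` {\<phi>}"

text \<open>A pointed set is a pair of a set and its distinguished point.\<close>

type_synonym 'a pointed_set = "'a set \<times> 'a"

definition pointed_iso :: "('a \<Rightarrow> 'b) \<Rightarrow> 'a pointed_set \<Rightarrow> 'b pointed_set \<Rightarrow> bool" where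
  "pointed_iso F A B \<longleftrightarrow> bij_betw F (fst A) (fst B) \<and> F (snd A) = snd B"

definition pointed_prod :: "'i set \<Rightarrow> ('i \<Rightarrow> 'a pointed_set) \<Rightarrow> ('i \<Rightarrow> 'a) pointed_set" where
  "pointed_prod I A = (\<Pi>\<^sub>E i\<in>I. fst (A i), \<lambda>i\<in>I. snd (A i))"

definition H1 ::
  "('k, 'x) monoid_scheme \<Rightarrow> ('n, 'y) monoid_scheme \<Rightarrow> ('k \<Rightarrow> 'n \<Rightarrow> 'n) \<Rightarrow> ('k \<Rightarrow> 'n) set pointed_set"
  where
  "H1 K N act =
     (crossed_homs K N act // cohomologous K N act,
      cohom_class K N act (\<lambda>k\<in>carrier K. \<one>\<^bsub>N\<^esub>))"

text \<open>\<open>\<phi>^j (x) = (\<phi> (x^(j^-1)))^j\<close> on a normal subgroup \<open>K\<close>, where \<open>x^(j^-1) = j x j^-1\<close>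
  since \<open>x^j = j^-1 x j\<close>.\<close>

definition crossed_hom_act ::
  "('j, 'x) monoid_scheme \<Rightarrow> ('j \<Rightarrow> 'n \<Rightarrow> 'n) \<Rightarrow> 'j set \<Rightarrow> 'j \<Rightarrow> ('j \<Rightarrow> 'n) \<Rightarrow> ('j \<Rightarrow> 'n)" where
  "crossed_hom_act J act K j \<phi> = (\<lambda>x\<in>K. act j (\<phi> (j \<otimes>\<^bsub>J\<^esub> x \<otimes>\<^bsub>J\<^esub> inv\<^bsub>J\<^esub> j)))"

text \<open>For normal \<open>K\<close>, the map above permutes the crossed homomorphisms on \<open>K\<close> and preserves the
  cohomology relation in both directions, so the induced action on classes is by direct image.\<close>

definition H1_fixed ::
  "('j, 'x) monoid_scheme \<Rightarrow> ('n, 'y) monoid_scheme \<Rightarrow> ('j \<Rightarrow> 'n \<Rightarrow> 'n) \<Rightarrow> 'j set \<Rightarrow> 'j set \<Rightarrow>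
     ('j \<Rightarrow> 'n) set pointed_set"
  where
  "H1_fixed J N act K Q =
     ({c \<in> fst (H1 (J\<lparr>carrier := K\<rparr>) N act). \<forall>j\<in>Q. crossed_hom_act J act K j ` c = c},
      snd (H1 (J\<lparr>carrier := K\<rparr>) N act))"

end

theory Submission
  imports Defs "HOL-Number_Theory.Cong"
begin

text \<open>
  Write \<open>N\<^sub>p\<close> for the Sylow subgroups of \<open>N\<close> and \<open>J = J\<^sub>p \<times> J'\<^sub>p\<close>. As \<open>N\<close> is the direct product
  of the \<open>N\<^sub>p\<close>, and the projections to the factors are power maps and hence commute with \<open>J\<close>,
  crossed homomorphisms and the elements that make them cohomologous can be handled one
  component at a time. The theorem is then a statement about the \<open>p\<close>-group
  \<open>N\<^sub>p\<close>: to its cohomology the group \<open>J'\<^sub>p\<close>, whose order is prime to \<open>p\<close>, contributes only the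
  condition that classes on \<open>J\<^sub>p\<close> be fixed.

  Everything about coprime orders comes from one result in the style of Glauberman,
  \<open>fixed_point_exists\<close>: if \<open>Q\<close> acts on a nilpotent group \<open>M\<close> of coprime order, and both act
  compatibly on a set on which \<open>M\<close> is transitive, then \<open>Q\<close> has a fixed point. A point moved
  by \<open>Q\<close> only along the \<open>i\<close>-th term of the lower central series of \<open>M\<close> is improved, by averaging
  in an abelian quotient of that term, to one moved only along the next term. The
  set is chosen in three ways.

  \<^item> For crossed homomorphisms \<open>f, g\<close> let \<open>k\<close> act on \<open>N\<close> by \<open>n \<mapsto> f(k) (\<alpha> k n) g(k)\<^sup>-\<^sup>1\<close>, where
    \<open>\<alpha> k\<close> is the action of \<open>k\<^sup>-\<^sup>1\<close>; a fixed point exhibits \<open>f\<close> and \<open>g\<close> as cohomologous. On the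
    kernel of the projection to \<open>N\<^sub>p\<close> this shows that classes on a \<open>p\<close>-group are determined by their \<open>N\<^sub>p\<close>-component
    (\<open>cohom_if_cohom_p_part\<close>).

  \<^item> The elements of \<open>N\<^sub>p\<close> fixed in this sense by \<open>J\<^sub>p\<close> form a coset on which \<open>J'\<^sub>p\<close> acts. A fixed
    point shows that the \<open>N\<^sub>p\<close>-component of a class on \<open>J\<close> is determined by the
    restriction to \<open>J\<^sub>p\<close> (\<open>p_part_cohom_if_restriction_cohom\<close>). This gives injectivity.

  \<^item> A class on \<open>J\<^sub>p\<close> fixed by \<open>J'\<^sub>p\<close>, projected to \<open>N\<^sub>p\<close>, is a set on which \<open>N\<^sub>p\<close> is transitive. It
    therefore contains a crossed homomorphism that is itself fixed by \<open>J'\<^sub>p\<close>, and its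
    composition with the projection \<open>J \<rightarrow> J\<^sub>p\<close> is a crossed homomorphism on \<open>J\<close>
    (\<open>extend_invariant_class\<close>). Multiplying these extensions over all primes, which is possible
    since different \<open>N\<^sub>p\<close> commute, gives surjectivity.

  Conversely the restriction of a class to \<open>J\<^sub>p\<close> is fixed by \<open>J'\<^sub>p\<close> because \<open>J'\<^sub>p\<close> centralizes \<open>J\<^sub>p\<close>
  (\<open>restriction_invariant\<close>).
\<close>

section \<open>Elementary group computations\<close>

lemma (in group) cancel_left:
  assumes "x \<in> carrier G" "y \<in> carrier G"
  shows "x \<otimes> (inv x \<otimes> y) = y" "inv x \<otimes> (x \<otimes> y) = y"
  using assms by (simp_all add: m_assoc [symmetric])

text \<open>
  Used with \<open>simp only\<close>, these rules normalize group words: they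
  reassociate to the right, push inverses to the letters and cancel adjacent inverse pairs.
\<close>

lemmas (in group) word_simps =
  m_assoc inv_mult_group cancel_left m_closed inv_closed inv_inv l_inv r_inv l_one r_one

lemma (in group) commute_inv:
  assumes "x \<in> carrier G" "y \<in> carrier G" "x \<otimes> y = y \<otimes> x"
  shows "inv x \<otimes> y = y \<otimes> inv x"
proof -
  have "inv x \<otimes> y = inv x \<otimes> (y \<otimes> x) \<otimes> inv x"
    using assms(1,2) by (simp only: word_simps)
  also have "\<dots> = inv x \<otimes> (x \<otimes> y) \<otimes> inv x"
    using assms(3) by (simp only:)
  also have "\<dots> = y \<otimes> inv x"
    using assms(1,2) by (simp only: word_simps)
  finally show ?thesis .
qed

lemma (in group) pow_eq_one_coprime:
  fixes m n :: nat
  assumes "x \<in> carrier G" "x [^] m = \<one>" "x [^] n = \<one>" "coprime m n"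
  shows "x = \<one>"
proof -
  have "ord x dvd m" "ord x dvd n"
    using assms pow_eq_id by auto
  then have "ord x = 1"
    using assms(4) coprime_common_divisor_nat by blast
  then show ?thesis
    using assms(1) ord_eq_1 by blast
qed

lemma (in group) pow_eq_one_dvd:
  fixes m n :: nat
  assumes "x \<in> carrier G" "x [^] m = \<one>" "m dvd n"
  shows "x [^] n = \<one>"
  using assms pow_eq_id by (meson dvd_trans)

lemma (in group) subgroup_pow_card:
  assumes "subgroup H G" "x \<in> H"
  shows "x [^] card H = \<one>"
proof -
  interpret H: group "G\<lparr>carrier := H\<rparr>"
    using assms(1) by (rule subgroup_imp_group)
  have "x [^]\<^bsub>G\<lparr>carrier := H\<rparr>\<^esub> order (G\<lparr>carrier := H\<rparr>) = \<one>"
    using H.pow_order_eq_1[of x] assms(2) by simp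
  then show ?thesis
    by (simp add: order_def nat_pow_consistent [symmetric])
qed

lemma (in group) subgroup_nat_pow_closed:
  assumes "subgroup H G" "x \<in> H"
  shows "x [^] (n :: nat) \<in> H"
  by (induct n) (use assms in \<open>auto simp: subgroup.one_closed subgroup.m_closed\<close>)

section \<open>The lower central series\<close>

lemma (in group) lower_central_series_normal:
  "lower_central_series G n \<lhd> G"
proof (induct n)
  case 0
  then show ?case by (simp add: normal_self)
next
  case (Suc n)
  let ?L = "lower_central_series G n"
  have L: "?L \<subseteq> carrier G"
    using Suc by (meson normal_imp_subgroup subgroup.subset)
  show ?case
    unfolding lower_central_series.simps commutator_subgroup_def
  proof (rule normal_generateI)
    show "(\<Union>h\<in>?L. \<Union>k\<in>carrier G. {h \<otimes> k \<otimes> inv h \<otimes> inv k}) \<subseteq> carrier G"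
      using L by auto
  next
    fix c g assume "c \<in> (\<Union>h\<in>?L. \<Union>k\<in>carrier G. {h \<otimes> k \<otimes> inv h \<otimes> inv k})"
      and g: "g \<in> carrier G"
    then obtain h k where hk: "h \<in> ?L" "k \<in> carrier G" "c = h \<otimes> k \<otimes> inv h \<otimes> inv k"
      by blast
    have h: "h \<in> carrier G" using hk(1) L by blast
    have "g \<otimes> h \<otimes> inv g \<in> ?L"
      by (rule normal.inv_op_closed2[OF Suc g hk(1)])
    moreover have "g \<otimes> c \<otimes> inv g
        = (g \<otimes> h \<otimes> inv g) \<otimes> (g \<otimes> k \<otimes> inv g) \<otimes> inv (g \<otimes> h \<otimes> inv g) \<otimes> inv (g \<otimes> k \<otimes> inv g)"
      using g h hk(2) by (simp only: hk(3) word_simps)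
    moreover have "g \<otimes> k \<otimes> inv g \<in> carrier G"
      using g hk(2) by simp
    ultimately show "g \<otimes> c \<otimes> inv g \<in> (\<Union>h\<in>?L. \<Union>k\<in>carrier G. {h \<otimes> k \<otimes> inv h \<otimes> inv k})"
      by (intro UN_I[of "g \<otimes> h \<otimes> inv g"] UN_I[of "g \<otimes> k \<otimes> inv g"]) simp_all
  qed
qed

lemma (in group) lower_central_series_subgroup:
  "subgroup (lower_central_series G n) G"
  using lower_central_series_normal normal_imp_subgroup by blast

lemma (in group) commutator_in_lower_central_series:
  assumes "x \<in> lower_central_series G n" "g \<in> carrier G"
  shows "x \<otimes> g \<otimes> inv x \<otimes> inv g \<in> lower_central_series G (Suc n)"
  unfolding lower_central_series.simps commutator_subgroup_def
  using assms by (intro generate.incl) blast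

lemma (in group) lower_central_series_Suc_subset:
  "lower_central_series G (Suc n) \<subseteq> lower_central_series G n"
proof -
  let ?L = "lower_central_series G n"
  interpret L: normal ?L G by (rule lower_central_series_normal)
  have "h \<otimes> k \<otimes> inv h \<otimes> inv k \<in> ?L" if "h \<in> ?L" "k \<in> carrier G" for h k
  proof -
    have "h \<otimes> (k \<otimes> inv h \<otimes> inv k) \<in> ?L"
      using that by (intro L.m_closed L.inv_op_closed2 L.m_inv_closed)
    then show ?thesis
      using that L.subset by (simp add: m_assoc subset_iff)
  qed
  then show ?thesis
    unfolding lower_central_series.simps commutator_subgroup_def
    by (intro generate_subgroup_incl L.subgroup_axioms) blast
qed

text \<open>The terms of the series are fully invariant, so every automorphism preserves them.\<close>

lemma (in group) hom_lower_central_series: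
  assumes "f \<in> hom G G" "x \<in> lower_central_series G n"
  shows "f x \<in> lower_central_series G n"
  using assms(2)
proof (induct n arbitrary: x)
  case 0
  then show ?case using assms(1) by (simp add: hom_in_carrier)
next
  case (Suc n)
  interpret f: group_hom G G f
    using assms(1) by (simp add: group_hom_def group_hom_axioms_def)
  interpret L: subgroup "lower_central_series G (Suc n)" G
    by (rule lower_central_series_subgroup)
  let ?C = "(\<Union>h\<in>lower_central_series G n. \<Union>k\<in>carrier G. {h \<otimes> k \<otimes> inv h \<otimes> inv k})"
  have sub: "lower_central_series G n \<subseteq> carrier G"
    using lower_central_series_subgroup subgroup.subset by blast
  have C: "f c \<in> lower_central_series G (Suc n)" if c: "c \<in> ?C" for c
  proof -
    obtain h k where hk: "h \<in> lower_central_series G n" "k \<in> carrier G"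
      "c = h \<otimes> k \<otimes> inv h \<otimes> inv k" using c by blast
    then show ?thesis
      using commutator_in_lower_central_series[OF Suc(1)[OF hk(1)], of "f k"] sub
      by auto
  qed
  have "x \<in> generate G ?C"
    using Suc(2) by (simp add: commutator_subgroup_def)
  moreover have "?C \<subseteq> carrier G"
    using sub by auto
  ultimately show ?case
  proof induct
    case (inv h)
    then have "h \<in> carrier G" by blast
    then show ?case using C inv by (simp del: lower_central_series.simps)
  next
    case (eng h1 h2)
    then have "h1 \<in> carrier G" "h2 \<in> carrier G"
      using generate_in_carrier by blast+
    then show ?case using eng by (simp del: lower_central_series.simps)
  qed (use C in \<open>auto simp del: lower_central_series.simps\<close>)
qed

lemma (in group) nilpotent_subgroup:
  assumes "nilpotent_group G" "subgroup H G"
  shows "nilpotent_group (G\<lparr>carrier := H\<rparr>)"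
proof -
  interpret H: group "G\<lparr>carrier := H\<rparr>"
    using assms(2) by (rule subgroup_imp_group)
  have sub: "lower_central_series (G\<lparr>carrier := H\<rparr>) n \<subseteq> lower_central_series G n" for n
  proof (induct n)
    case 0
    then show ?case using assms(2) subgroup.subset by auto
  next
    case (Suc n)
    let ?L = "lower_central_series (G\<lparr>carrier := H\<rparr>) n"
    have LH: "?L \<subseteq> H"
      using H.lower_central_series_subgroup subgroup.subset by fastforce
    have HG: "H \<subseteq> carrier G"
      using assms(2) subgroup.subset by blast
    have "h \<otimes> k \<otimes> inv\<^bsub>G\<lparr>carrier := H\<rparr>\<^esub> h \<otimes> inv\<^bsub>G\<lparr>carrier := H\<rparr>\<^esub> k \<in> lower_central_series G (Suc n)"
      if hk: "h \<in> ?L" "k \<in> H" for h k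
    proof -
      have "h \<in> H" using hk(1) LH by blast
      then show ?thesis
        using commutator_in_lower_central_series[of h n k] hk Suc HG
        by (simp add: m_inv_consistent[OF assms(2)] subset_iff del: lower_central_series.simps)
    qed
    moreover have "h \<otimes> k \<otimes> inv\<^bsub>G\<lparr>carrier := H\<rparr>\<^esub> h \<otimes> inv\<^bsub>G\<lparr>carrier := H\<rparr>\<^esub> k \<in> H"
      if "h \<in> ?L" "k \<in> H" for h k
      using that LH H.m_closed H.inv_closed by (simp add: subset_iff)
    ultimately have "generate G (\<Union>h\<in>?L. \<Union>k\<in>H. {h \<otimes> k \<otimes> inv\<^bsub>G\<lparr>carrier := H\<rparr>\<^esub> h \<otimes> inv\<^bsub>G\<lparr>carrier := H\<rparr>\<^esub> k})
        \<subseteq> lower_central_series G (Suc n)"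
      by (intro generate_subgroup_incl lower_central_series_subgroup) blast
    moreover have "generate (G\<lparr>carrier := H\<rparr>) (\<Union>h\<in>?L. \<Union>k\<in>H. {h \<otimes> k \<otimes> inv\<^bsub>G\<lparr>carrier := H\<rparr>\<^esub> h \<otimes> inv\<^bsub>G\<lparr>carrier := H\<rparr>\<^esub> k})
       = generate G (\<Union>h\<in>?L. \<Union>k\<in>H. {h \<otimes> k \<otimes> inv\<^bsub>G\<lparr>carrier := H\<rparr>\<^esub> h \<otimes> inv\<^bsub>G\<lparr>carrier := H\<rparr>\<^esub> k})"
      using \<open>\<And>k h. \<lbrakk>h \<in> ?L; k \<in> H\<rbrakk> \<Longrightarrow> h \<otimes> k \<otimes> inv\<^bsub>G\<lparr>carrier := H\<rparr>\<^esub> h \<otimes> inv\<^bsub>G\<lparr>carrier := H\<rparr>\<^esub> k \<in> H\<close>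
      by (intro generate_consistent assms(2)) blast
    ultimately show ?case
      unfolding lower_central_series.simps(2)[of "G\<lparr>carrier := H\<rparr>"] commutator_subgroup_def
      by simp
  qed
  obtain n where "lower_central_series G n = {\<one>}"
    using assms(1) unfolding nilpotent_group_def by blast
  moreover have "\<one> \<in> lower_central_series (G\<lparr>carrier := H\<rparr>) n"
    using subgroup.one_closed[OF H.lower_central_series_subgroup[of n]] by simp
  ultimately have "lower_central_series (G\<lparr>carrier := H\<rparr>) n = {\<one>}"
    using sub[of n] by blast
  then show ?thesis
    unfolding nilpotent_group_def using H.group_axioms by auto
qed

section \<open>Hall subgroups of a finite nilpotent group\<close>

lemma (in group) central_commutator_pow:
  fixes m :: nat
  assumes x: "x \<in> carrier G" and y: "y \<in> carrier G" and c: "c \<in> carrier G"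
    and xy: "x \<otimes> y = c \<otimes> (y \<otimes> x)" and cx: "c \<otimes> x = x \<otimes> c"
    and m: "x [^] m = \<one>"
  shows "c [^] m = \<one>"
proof -
  have "x [^] m \<otimes> y = c [^] m \<otimes> (y \<otimes> x [^] m)"
  proof (induct m)
    case 0
    then show ?case using y by simp
  next
    case (Suc m)
    have cm: "x \<otimes> c [^] m = c [^] m \<otimes> x"
      using c x cx by (induct m) (simp_all, metis m_assoc nat_pow_closed)
    have "x [^] Suc m \<otimes> y = x \<otimes> (x [^] m \<otimes> y)"
      using x y by (simp only: nat_pow_Suc2 m_assoc nat_pow_closed)
    also have "\<dots> = (x \<otimes> c [^] m) \<otimes> (y \<otimes> x [^] m)"
      using x y c Suc by (simp add: m_assoc)
    also have "\<dots> = c [^] m \<otimes> (x \<otimes> y) \<otimes> x [^] m"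
      using x y c by (simp add: cm m_assoc)
    also have "\<dots> = c [^] Suc m \<otimes> (y \<otimes> x [^] Suc m)"
      using x y c by (simp only: xy nat_pow_Suc2[of x] nat_pow_Suc[of c] m_assoc m_closed nat_pow_closed)
    finally show ?case .
  qed
  then have "\<one> \<otimes> y = c [^] m \<otimes> y"
    using m y by simp
  then show ?thesis
    using c y by (metis r_cancel nat_pow_closed one_closed)
qed

text \<open>
  The commutator \<open>c\<close> of \<open>x\<close> and \<open>y\<close> lies in every term of the lower central series. If it lies in
  one term then it is central modulo the next term \<open>B\<close>, so that \<open>c\<^sup>m\<close> is the commutator of \<open>x\<^sup>m\<close> and
  \<open>y\<close> modulo \<open>B\<close>, and similarly for \<open>c\<^sup>n\<close>. Both powers are thus trivial modulo \<open>B\<close>, and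
  \<open>c \<in> B\<close> because \<open>m\<close> and \<open>n\<close> are coprime.
\<close>

lemma (in group) nilpotent_coprime_commute:
  fixes m n :: nat
  assumes nil: "nilpotent_group G"
    and x: "x \<in> carrier G" and y: "y \<in> carrier G"
    and xm: "x [^] m = \<one>" and yn: "y [^] n = \<one>" and mn: "coprime m n"
  shows "x \<otimes> y = y \<otimes> x"
proof -
  define c where "c = x \<otimes> y \<otimes> inv x \<otimes> inv y"
  have c: "c \<in> carrier G" using x y by (simp add: c_def)
  have "c \<in> lower_central_series G i" for i
  proof (induct i)
    case 0
    then show ?case using c by simp
  next
    case (Suc i)
    define B where "B = lower_central_series G (Suc i)"
    interpret B: normal B G unfolding B_def by (rule lower_central_series_normal)
    interpret Q: group "G Mod B" by (rule B.factorgroup_is_group)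
    define h where "h = (\<lambda>a. B #> a)"
    interpret h: group_hom G "G Mod B" h
      unfolding h_def using B.r_coset_hom_Mod
      by (simp add: group_hom_def group_hom_axioms_def)
    have ker: "h a = \<one>\<^bsub>G Mod B\<^esub> \<longleftrightarrow> a \<in> B" if "a \<in> carrier G" for a
      using that coset_join1[OF _ that B.subgroup_axioms] coset_join2[OF that B.subgroup_axioms]
      by (auto simp: h_def FactGroup_def)
    have central: "h c \<otimes>\<^bsub>G Mod B\<^esub> h g = h g \<otimes>\<^bsub>G Mod B\<^esub> h c" if g: "g \<in> carrier G" for g
    proof -
      have "c \<otimes> g \<otimes> inv c \<otimes> inv g \<in> B"
        unfolding B_def using Suc g by (rule commutator_in_lower_central_series)
      then have "h (c \<otimes> g \<otimes> inv c \<otimes> inv g) = \<one>\<^bsub>G Mod B\<^esub>"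
        using c g by (subst ker) simp_all
      then have "h (c \<otimes> g \<otimes> inv c \<otimes> inv g) \<otimes>\<^bsub>G Mod B\<^esub> h (g \<otimes> c) = h (g \<otimes> c)"
        using c g by (simp only: Q.l_one h.hom_closed m_closed)
      moreover have "h (c \<otimes> g \<otimes> inv c \<otimes> inv g) \<otimes>\<^bsub>G Mod B\<^esub> h (g \<otimes> c) = h (c \<otimes> g)"
        using c g by (subst h.hom_mult[symmetric]) (simp_all only: word_simps)
      ultimately show ?thesis using c g by simp
    qed
    have xyc: "x \<otimes> y = c \<otimes> (y \<otimes> x)" "y \<otimes> x = inv c \<otimes> (x \<otimes> y)"
      using x y by (simp_all only: c_def word_simps)
    have h1: "h c [^]\<^bsub>G Mod B\<^esub> m = \<one>\<^bsub>G Mod B\<^esub>"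
    proof (rule Q.central_commutator_pow[of "h x" "h y"])
      show "h x \<otimes>\<^bsub>G Mod B\<^esub> h y = h c \<otimes>\<^bsub>G Mod B\<^esub> (h y \<otimes>\<^bsub>G Mod B\<^esub> h x)"
        using x y c arg_cong[OF xyc(1), of h] by simp
      show "h x [^]\<^bsub>G Mod B\<^esub> m = \<one>\<^bsub>G Mod B\<^esub>"
        using x xm by (simp add: h.hom_nat_pow[symmetric])
    qed (use x y c central in auto)
    have h2: "h (inv c) [^]\<^bsub>G Mod B\<^esub> n = \<one>\<^bsub>G Mod B\<^esub>"
    proof (rule Q.central_commutator_pow[of "h y" "h x"])
      show "h y \<otimes>\<^bsub>G Mod B\<^esub> h x = h (inv c) \<otimes>\<^bsub>G Mod B\<^esub> (h x \<otimes>\<^bsub>G Mod B\<^esub> h y)"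
        using x y c arg_cong[OF xyc(2), of h] by simp
      show "h y [^]\<^bsub>G Mod B\<^esub> n = \<one>\<^bsub>G Mod B\<^esub>"
        using y yn by (simp add: h.hom_nat_pow[symmetric])
      show "h (inv c) \<otimes>\<^bsub>G Mod B\<^esub> h y = h y \<otimes>\<^bsub>G Mod B\<^esub> h (inv c)"
        using Q.commute_inv[OF _ _ central[OF y]] c y by simp
    qed (use x y c in auto)
    have "inv\<^bsub>G Mod B\<^esub> (h c [^]\<^bsub>G Mod B\<^esub> n) = \<one>\<^bsub>G Mod B\<^esub>"
      using h2 c by (simp add: Q.nat_pow_inv)
    then have "h c [^]\<^bsub>G Mod B\<^esub> n = \<one>\<^bsub>G Mod B\<^esub>"
      using c Q.inv_eq_1_iff[of "h c [^]\<^bsub>G Mod B\<^esub> n"] by simp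
    then have "h c = \<one>\<^bsub>G Mod B\<^esub>"
      using h1 Q.pow_eq_one_coprime[OF _ h1 _ mn] c by simp
    then show ?case using ker[OF c] by (simp add: B_def)
  qed
  moreover obtain i where "lower_central_series G i = {\<one>}"
    using nil unfolding nilpotent_group_def by blast
  ultimately have "c = \<one>" by blast
  then have "c \<otimes> (y \<otimes> x) = y \<otimes> x" using x y by simp
  moreover have "c \<otimes> (y \<otimes> x) = x \<otimes> y" using x y by (simp only: c_def word_simps)
  ultimately show ?thesis by simp
qed

lemma (in group) card_mult_coprime:
  assumes H: "subgroup H G" and K: "subgroup K G"
    and cop: "coprime (card H) (card K)"
  shows "card ((\<lambda>(h, k). h \<otimes> k) ` (H \<times> K)) = card H * card K"
proof -
  have HG: "H \<subseteq> carrier G" "K \<subseteq> carrier G"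
    using H K subgroup.subset by blast+
  have "inj_on (\<lambda>(h, k). h \<otimes> k) (H \<times> K)"
  proof (rule inj_onI, clarify)
    fix h k h' k' assume a: "h \<in> H" "k \<in> K" "h' \<in> H" "k' \<in> K" and eq: "h \<otimes> k = h' \<otimes> k'"
    have car: "h \<in> carrier G" "k \<in> carrier G" "h' \<in> carrier G" "k' \<in> carrier G"
      using a HG by blast+
    have eq2: "inv h' \<otimes> h = k' \<otimes> inv k"
    proof -
      have "inv h' \<otimes> h = inv h' \<otimes> (h \<otimes> k) \<otimes> inv k"
        using car by (simp only: word_simps)
      also have "\<dots> = k' \<otimes> inv k"
        using car by (simp only: eq word_simps)
      finally show ?thesis .
    qed
    have "inv h' \<otimes> h \<in> H"
      using a H by (blast intro: subgroup.m_closed subgroup.m_inv_closed)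
    moreover have "inv h' \<otimes> h \<in> K"
      unfolding eq2 using a K by (blast intro: subgroup.m_closed subgroup.m_inv_closed)
    ultimately have "inv h' \<otimes> h = \<one>"
      using car by (intro pow_eq_one_coprime[OF _ subgroup_pow_card[OF H] subgroup_pow_card[OF K] cop]) simp_all
    then have "h = h'"
      using car inv_equality[of "inv h'" h] by (metis inv_closed inv_inv)
    then show "h = h' \<and> k = k'"
      using eq car by simp
  qed
  then show ?thesis
    by (simp add: card_image card_cartesian_product)
qed

text \<open>
  Sylow subgroups for distinct primes commute elementwise, so products of them
  are again subgroups.
\<close>

lemma (in group) nilpotent_hall_exists:
  assumes nil: "nilpotent_group G" and fin: "finite (carrier G)"
    and "order G = a * b" "coprime a b"
  shows "\<exists>H. subgroup H G \<and> card H = a"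
  using assms(3,4)
proof (induct a arbitrary: b rule: less_induct)
  case (less a)
  have pos: "a > 0" "b > 0"
    using less.prems(1) fin order_gt_0_iff_finite by (metis mult_is_0 neq0_conv)+
  show ?case
  proof (cases "a = 1")
    case True
    then show ?thesis
      using triv_subgroup by (intro exI[of _ "{\<one>}"]) simp
  next
    case False
    then obtain p :: nat where p: "Factorial_Ring.prime p" "p dvd a"
      using prime_factor_nat by blast
    define k where "k = multiplicity p a"
    obtain a' where a': "a = p ^ k * a'"
      using multiplicity_dvd[of p a] unfolding k_def by (auto elim: dvdE)
    have na': "\<not> p dvd a'"
      using multiplicity_decompose'[of a p] p pos
      by (metis a' k_def dvd_def mult_left_cancel neq0_conv not_prime_unit power_not_zero not_prime_0)
    have "k > 0"
      using p pos by (simp add: k_def prime_multiplicity_gt_zero_iff)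
    then have "1 < p ^ k"
      using p(1) prime_gt_1_nat one_less_power by blast
    then have "a' < a"
      using a' pos by simp
    moreover have cop: "coprime (p ^ k) a'"
      using na' p(1) prime_imp_coprime_nat by auto
    moreover have "coprime a' (p ^ k * b)"
      using cop less.prems(2) by (simp add: a' coprime_commute)
    moreover have "order G = a' * (p ^ k * b)"
      using less.prems(1) a' by simp
    ultimately obtain H where H: "subgroup H G" "card H = a'"
      using less.hyps[of a' "p ^ k * b"] by blast
    obtain P where P: "subgroup P G" "card P = p ^ k"
      using Sylow.sylow_thm[OF p(1) group_axioms _ fin, of k "a' * b"] less.prems(1) a'
      by (auto simp: ac_simps)
    have HG: "H \<subseteq> carrier G" "P \<subseteq> carrier G"
      using H P subgroup.subset by blast+
    have com: "h \<otimes> x = x \<otimes> h" if "h \<in> H" "x \<in> P" for h x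
      using nilpotent_coprime_commute[OF nil _ _ subgroup_pow_card[OF H(1) that(1)]
          subgroup_pow_card[OF P(1) that(2)]] cop that HG P(2) H(2)
      by (auto simp: coprime_commute)
    let ?S = "(\<lambda>(h, k). h \<otimes> k) ` (P \<times> H)"
    have "subgroup ?S G"
    proof (rule subgroupI)
      show "?S \<subseteq> carrier G" using HG by auto
      show "?S \<noteq> {}"
        using H(1) P(1) subgroup.one_closed by fastforce
    next
      fix s assume "s \<in> ?S"
      then obtain x h where xh: "x \<in> P" "h \<in> H" "s = x \<otimes> h" by auto
      have "inv s = inv x \<otimes> inv h"
        using xh HG com by (metis inv_mult_group subsetD)
      then show "inv s \<in> ?S"
        using xh H P by (auto intro: subgroup.m_inv_closed)
    next
      fix s t assume "s \<in> ?S" "t \<in> ?S"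
      then obtain x h y g where xh: "x \<in> P" "h \<in> H" "s = x \<otimes> h" "y \<in> P" "g \<in> H" "t = y \<otimes> g"
        by auto
      have "s \<otimes> t = x \<otimes> (h \<otimes> y) \<otimes> g"
        using xh HG by (simp add: m_assoc subset_iff)
      also have "\<dots> = x \<otimes> (y \<otimes> h) \<otimes> g"
        using com[OF xh(2,4)] by (simp only:)
      also have "\<dots> = (x \<otimes> y) \<otimes> (h \<otimes> g)"
        using xh HG by (simp add: m_assoc subset_iff)
      finally show "s \<otimes> t \<in> ?S"
        using xh H P by (auto intro: subgroup.m_closed)
    qed
    moreover have "card ?S = a"
      using card_mult_coprime[OF P(1) H(1)] cop P(2) H(2) a' by simp
    ultimately show ?thesis by blast
  qed
qed

definition power_kernel :: "('a, 'x) monoid_scheme \<Rightarrow> nat \<Rightarrow> 'a set" where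
  "power_kernel G a = {x \<in> carrier G. x [^]\<^bsub>G\<^esub> a = \<one>\<^bsub>G\<^esub>}"

text \<open>
  The Hall subgroups \<open>H\<close> and \<open>K\<close> of orders \<open>a\<close> and \<open>b\<close> commute and fill up the group by counting. An element
  killed by \<open>a\<close> has a trivial \<open>K\<close>-component; hence \<open>H\<close> is the set of all such elements,
  which makes it canonical.
\<close>

lemma (in group) nilpotent_hall_decomposition:
  assumes nil: "nilpotent_group G" and fin: "finite (carrier G)"
    and ab: "order G = a * b" and cop: "coprime a b"
  shows "subgroup (power_kernel G a) G" "card (power_kernel G a) = a"
    and "\<And>g. g \<in> carrier G \<Longrightarrow> \<exists>x\<in>power_kernel G a. \<exists>y\<in>power_kernel G b. g = x \<otimes> y"
proof -
  obtain H where H: "subgroup H G" "card H = a"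
    using nilpotent_hall_exists[OF nil fin ab cop] by blast
  obtain K where K: "subgroup K G" "card K = b"
    using nilpotent_hall_exists[OF nil fin, of b a] ab cop
    by (auto simp: coprime_commute mult.commute)
  have HG: "H \<subseteq> carrier G" "K \<subseteq> carrier G"
    using H K subgroup.subset by blast+
  have Hp: "H \<subseteq> power_kernel G a" and Kp: "K \<subseteq> power_kernel G b"
    using HG subgroup_pow_card[OF H(1)] subgroup_pow_card[OF K(1)] H K
    by (auto simp: power_kernel_def)
  let ?S = "(\<lambda>(h, k). h \<otimes> k) ` (H \<times> K)"
  have "card ?S = card (carrier G)"
    using card_mult_coprime[OF H(1) K(1)] H(2) K(2) cop ab by (simp add: order_def)
  moreover have "?S \<subseteq> carrier G" using HG by auto
  ultimately have S: "?S = carrier G"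
    using fin card_subset_eq by blast
  show "\<exists>x\<in>power_kernel G a. \<exists>y\<in>power_kernel G b. g = x \<otimes> y" if "g \<in> carrier G" for g
  proof -
    have "g \<in> ?S" using that S by simp
    then show ?thesis using Hp Kp by auto
  qed
  have "power_kernel G a \<subseteq> H"
  proof
    fix x assume x: "x \<in> power_kernel G a"
    then have "x \<in> ?S" using S by (simp add: power_kernel_def)
    then obtain h k where hk: "h \<in> H" "k \<in> K" "x = h \<otimes> k" by auto
    have pw: "h [^] a = \<one>" "k [^] b = \<one>" "h \<in> carrier G" "k \<in> carrier G"
      using hk Hp Kp by (auto simp: power_kernel_def)
    have "h \<otimes> k = k \<otimes> h"
      using nilpotent_coprime_commute[OF nil pw(3,4,1,2) cop] .
    then have "x [^] a = k [^] a"
      using hk pw by (simp add: pow_mult_distrib)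
    then have "k = \<one>"
      using x pw pow_eq_one_coprime[OF pw(4) _ pw(2) cop] by (simp add: power_kernel_def)
    then show "x \<in> H" using hk pw by simp
  qed
  then have "power_kernel G a = H" using Hp by blast
  then show "subgroup (power_kernel G a) G" "card (power_kernel G a) = a"
    using H by auto
qed

section \<open>Primary parts in a finite nilpotent group\<close>

lemma (in group) pow_cong_one:
  assumes x: "x \<in> carrier G" "x [^] n = \<one>" and e: "[e = 1] (mod n)" and n: "n > 0"
  shows "x [^] (e :: nat) = x"
proof -
  have "[e + n = 1] (mod n)"
    using e by (simp add: cong_def)
  moreover have "1 \<le> e + n"
    using n by simp
  ultimately obtain k where k: "e + n = k * n + 1"
    using cong_le_nat by blast
  have "x [^] e = x [^] (e + n)"
    using x by (simp add: nat_pow_mult [symmetric])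
  also have "\<dots> = (x [^] n) [^] k \<otimes> x"
    unfolding k using x(1) by (simp add: nat_pow_pow mult.commute)
  finally show ?thesis
    using x by simp
qed

locale finite_nilpotent_group = group +
  assumes nilpotent: "nilpotent_group G" and finite: "finite (carrier G)"
begin

definition p_order :: "nat \<Rightarrow> nat" where
  "p_order p = p ^ multiplicity p (order G)"

definition p'_order :: "nat \<Rightarrow> nat" where
  "p'_order p = order G div p_order p"

definition p_subgroup :: "nat \<Rightarrow> 'a set" where
  "p_subgroup p = power_kernel G (p_order p)"

definition p'_subgroup :: "nat \<Rightarrow> 'a set" where
  "p'_subgroup p = power_kernel G (p'_order p)"

text \<open>
  By the Chinese remainder theorem there is an exponent for which taking powers is the identity on the
  \<open>p\<close>-component and trivial on the complementary one. Realizing the projection as a power map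
  makes it visibly compatible with every endomorphism (\<open>p_part_endo\<close> below).
\<close>

definition p_exponent :: "nat \<Rightarrow> nat" where
  "p_exponent p = (SOME e. [e = 1] (mod p_order p) \<and> p'_order p dvd e)"

definition p_part :: "nat \<Rightarrow> 'a \<Rightarrow> 'a" where
  "p_part p x = x [^] p_exponent p"

lemma order_pos: "order G > 0"
  using finite order_gt_0_iff_finite by blast

lemma order_split: "order G = p_order p * p'_order p"
  by (simp add: p'_order_def p_order_def multiplicity_dvd)

lemma not_dvd_p'_order:
  assumes "Factorial_Ring.prime p"
  shows "\<not> p dvd p'_order p"
  unfolding p'_order_def p_order_def
  using assms order_pos by (intro multiplicity_decompose) (auto simp: prime_nat_iff)

lemma coprime_orders:
  assumes "Factorial_Ring.prime p"
  shows "coprime (p_order p) (p'_order p)"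
  using prime_imp_coprime_nat[OF assms not_dvd_p'_order[OF assms]] by (simp add: p_order_def)

lemma p_exponent:
  assumes "Factorial_Ring.prime p"
  shows "[p_exponent p = 1] (mod p_order p)" "p'_order p dvd p_exponent p"
proof -
  obtain e where "[e = 1] (mod p_order p)" "[e = 0] (mod p'_order p)"
    using binary_chinese_remainder_nat[OF coprime_orders[OF assms]] by blast
  then have "\<exists>e. [e = 1] (mod p_order p) \<and> p'_order p dvd e"
    using cong_0_iff by blast
  then show "[p_exponent p = 1] (mod p_order p)" "p'_order p dvd p_exponent p"
    unfolding p_exponent_def by (metis (mono_tags, lifting) someI_ex)+
qed

context
  fixes p :: nat
  assumes p: "Factorial_Ring.prime p"
begin

lemmas hall = nilpotent_hall_decomposition[OF nilpotent finite order_split[of p] coprime_orders[OF p]]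
lemmas hall' = nilpotent_hall_decomposition[OF nilpotent finite, of "p'_order p" "p_order p"]

lemma p_subgroup: "subgroup (p_subgroup p) G" and card_p_subgroup: "card (p_subgroup p) = p_order p"
  using hall by (simp_all add: p_subgroup_def)

lemma p'_subgroup: "subgroup (p'_subgroup p) G" and card_p'_subgroup: "card (p'_subgroup p) = p'_order p"
  using hall' order_split[of p] coprime_orders[OF p]
  by (simp_all add: p'_subgroup_def mult.commute coprime_commute)

lemma p_subgroup_closed: "x \<in> p_subgroup p \<Longrightarrow> x \<in> carrier G"
  by (simp add: p_subgroup_def power_kernel_def)

lemma p'_subgroup_closed: "x \<in> p'_subgroup p \<Longrightarrow> x \<in> carrier G"
  by (simp add: p'_subgroup_def power_kernel_def)

lemma p_p'_commute:
  assumes "x \<in> p_subgroup p" "y \<in> p'_subgroup p"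
  shows "x \<otimes> y = y \<otimes> x"
  using assms
  by (intro nilpotent_coprime_commute[OF nilpotent _ _ _ _ coprime_orders[OF p]])
    (simp_all add: p_subgroup_def p'_subgroup_def power_kernel_def)

lemma p_part_closed [simp]: "x \<in> carrier G \<Longrightarrow> p_part p x \<in> carrier G"
  by (simp add: p_part_def)

lemma p_part_p_subgroup:
  assumes "x \<in> p_subgroup p"
  shows "p_part p x = x"
proof -
  have x: "x \<in> carrier G" "x [^] p_order p = \<one>"
    using assms by (simp_all add: p_subgroup_def power_kernel_def)
  have "p_order p > 0"
    using p by (simp add: p_order_def prime_gt_0_nat)
  then show ?thesis
    using pow_cong_one[OF x p_exponent(1)[OF p]] by (simp add: p_part_def)
qed

lemma p_part_p'_subgroup:
  assumes "x \<in> p'_subgroup p"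
  shows "p_part p x = \<one>"
  using assms pow_eq_one_dvd[OF _ _ p_exponent(2)[OF p]]
  by (simp add: p'_subgroup_def power_kernel_def p_part_def)

lemma p_part_mult_p_p':
  assumes "x \<in> p_subgroup p" "y \<in> p'_subgroup p"
  shows "p_part p (x \<otimes> y) = x"
proof -
  have "p_part p (x \<otimes> y) = p_part p x \<otimes> p_part p y"
    unfolding p_part_def
    using assms by (intro pow_mult_distrib p_p'_commute p_subgroup_closed p'_subgroup_closed)
  then show ?thesis
    using assms by (simp add: p_part_p_subgroup p_part_p'_subgroup p_subgroup_closed)
qed

lemma p_p'_decompose:
  assumes "g \<in> carrier G"
  obtains y where "y \<in> p'_subgroup p" "p_part p g \<in> p_subgroup p" "g = p_part p g \<otimes> y"
proof -
  obtain x y where "x \<in> p_subgroup p" "y \<in> p'_subgroup p" "g = x \<otimes> y"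
    using hall(3)[OF assms] by (auto simp: p_subgroup_def p'_subgroup_def)
  then show ?thesis
    using p_part_mult_p_p' that by metis
qed

lemma p_part_in_p_subgroup: "g \<in> carrier G \<Longrightarrow> p_part p g \<in> p_subgroup p"
  using p_p'_decompose by metis

lemma p_part_eq_one_iff:
  assumes "g \<in> carrier G"
  shows "p_part p g = \<one> \<longleftrightarrow> g \<in> p'_subgroup p"
  using p_p'_decompose[OF assms] p_part_p'_subgroup p'_subgroup_closed by (metis l_one)

lemma p_part_mult:
  assumes g: "g \<in> carrier G" and h: "h \<in> carrier G"
  shows "p_part p (g \<otimes> h) = p_part p g \<otimes> p_part p h"
proof -
  obtain y where y: "y \<in> p'_subgroup p" "g = p_part p g \<otimes> y"
    using p_p'_decompose[OF g] .
  obtain z where z: "z \<in> p'_subgroup p" "h = p_part p h \<otimes> z"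
    using p_p'_decompose[OF h] .
  have c: "y \<in> carrier G" "z \<in> carrier G"
    using y z p'_subgroup_closed by auto
  have "g \<otimes> h = (p_part p g \<otimes> y) \<otimes> (p_part p h \<otimes> z)"
    using y(2) z(2) by simp
  also have "\<dots> = p_part p g \<otimes> (y \<otimes> p_part p h) \<otimes> z"
    using c g h by (simp only: m_assoc m_closed p_part_closed)
  also have "y \<otimes> p_part p h = p_part p h \<otimes> y"
    using p_p'_commute[OF p_part_in_p_subgroup[OF h] y(1)] by simp
  also have "p_part p g \<otimes> (p_part p h \<otimes> y) \<otimes> z = (p_part p g \<otimes> p_part p h) \<otimes> (y \<otimes> z)"
    using c g h by (simp only: m_assoc m_closed p_part_closed)
  finally have "g \<otimes> h = (p_part p g \<otimes> p_part p h) \<otimes> (y \<otimes> z)" .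
  moreover have "p_part p g \<otimes> p_part p h \<in> p_subgroup p" "y \<otimes> z \<in> p'_subgroup p"
    using g h y(1) z(1) p_subgroup p'_subgroup
    by (auto intro: subgroup.m_closed p_part_in_p_subgroup)
  ultimately show ?thesis
    using p_part_mult_p_p' by simp
qed

lemma p_part_hom: "group_hom G G (p_part p)"
  by unfold_locales (auto simp: hom_def p_part_mult)

lemma p_part_one [simp]: "p_part p \<one> = \<one>"
  by (simp add: p_part_def)

lemma p_part_inv: "x \<in> carrier G \<Longrightarrow> p_part p (inv x) = inv (p_part p x)"
  using group_hom.hom_inv[OF p_part_hom] by blast

lemma p_part_idem: "x \<in> carrier G \<Longrightarrow> p_part p (p_part p x) = p_part p x"
  by (simp add: p_part_in_p_subgroup p_part_p_subgroup)

lemma p_part_endo: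
  assumes "f \<in> hom G G" "x \<in> carrier G"
  shows "f (p_part p x) = p_part p (f x)"
  unfolding p_part_def using hom_nat_pow[OF assms group_axioms group_axioms] .

text \<open>
  A subgroup of order \<open>p_order p\<close> is killed by this number, hence contained in \<open>p_subgroup p\<close>, and
  equal to it by counting; the Hall complement is treated in the same way.
\<close>

lemma sylow_subgroup_eq: "sylow_subgroup G p = p_subgroup p"
  unfolding sylow_subgroup_def
proof (rule the_equality)
  show "is_sylow_subgroup G p (p_subgroup p)"
    using p_subgroup card_p_subgroup by (simp add: is_sylow_subgroup_def p_order_def)
next
  fix P assume "is_sylow_subgroup G p P"
  then have P: "subgroup P G" "card P = p_order p"
    by (simp_all add: is_sylow_subgroup_def p_order_def)
  then have "P \<subseteq> p_subgroup p"
    using subgroup_pow_card[OF P(1)] subgroup.subset[OF P(1)]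
    by (auto simp: p_subgroup_def power_kernel_def)
  moreover have "finite (p_subgroup p)"
    by (rule finite_subset[OF subgroup.subset[OF p_subgroup] finite])
  ultimately show "P = p_subgroup p"
    using P(2) card_p_subgroup card_subset_eq by metis
qed

lemma hall_complement_subgroup_eq: "hall_complement_subgroup G p = p'_subgroup p"
  unfolding hall_complement_subgroup_def
proof (rule the_equality)
  have "card (rcosets (p'_subgroup p)) * p'_order p = p_order p * p'_order p"
    using lagrange[OF p'_subgroup] order_split card_p'_subgroup by simp
  moreover have "p'_order p \<noteq> 0"
    using order_pos order_split[of p] by (metis mult_is_0 neq0_conv)
  ultimately have "card (rcosets (p'_subgroup p)) = p_order p"
    by simp
  then show "is_hall_complement_subgroup G p (p'_subgroup p)"
    using p'_subgroup card_p'_subgroup not_dvd_p'_order[OF p]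
    by (auto simp: is_hall_complement_subgroup_def p_order_def)
next
  fix Q assume "is_hall_complement_subgroup G p Q"
  then obtain k where Q: "subgroup Q G" "\<not> p dvd card Q" "card (rcosets Q) = p ^ k"
    by (auto simp: is_hall_complement_subgroup_def)
  have eq: "order G = p ^ k * card Q"
    using lagrange[OF Q(1)] Q(3) by simp
  have "card Q > 0"
    using order_pos eq by (metis mult_0_right neq0_conv)
  then have "multiplicity p (order G) = k"
    using p Q(2) by (simp add: eq prime_elem_multiplicity_mult_distrib not_dvd_imp_multiplicity_0
        prime_gt_0_nat prime_nat_iff)
  then have "card Q = p'_order p"
    using eq p by (simp add: p'_order_def p_order_def prime_gt_0_nat)
  then have "Q \<subseteq> p'_subgroup p"
    using subgroup_pow_card[OF Q(1)] subgroup.subset[OF Q(1)]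
    by (auto simp: p'_subgroup_def power_kernel_def)
  moreover have "finite (p'_subgroup p)"
    by (rule finite_subset[OF subgroup.subset[OF p'_subgroup] finite])
  ultimately show "Q = p'_subgroup p"
    using \<open>card Q = p'_order p\<close> card_p'_subgroup card_subset_eq by metis
qed

end

lemma p_part_p_part_distinct:
  assumes p: "Factorial_Ring.prime p" and q: "Factorial_Ring.prime q" and "p \<noteq> q"
    and x: "x \<in> carrier G"
  shows "p_part p (p_part q x) = \<one>"
proof -
  have "coprime (p_order q) (p_order p)"
    using assms(1-3) by (simp add: p_order_def primes_coprime)
  moreover have "p_order q dvd p_order p * p'_order p"
    using order_split[of q] order_split[of p] by (metis dvd_triv_left)
  ultimately have "p_order q dvd p'_order p"
    by (simp add: coprime_dvd_mult_right_iff)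
  moreover have "p_part q x [^] p_order q = \<one>"
    using p_part_in_p_subgroup[OF q x] by (simp add: p_subgroup_def power_kernel_def)
  ultimately have "p_part q x \<in> p'_subgroup p"
    using x q pow_eq_one_dvd by (simp add: p'_subgroup_def power_kernel_def)
  then show ?thesis
    by (rule p_part_p'_subgroup[OF p])
qed

text \<open>
  If all primary parts of an element are trivial then no prime divides its order.
\<close>

lemma p_part_separate:
  assumes x: "x \<in> carrier G" and y: "y \<in> carrier G"
    and eq: "\<And>p. Factorial_Ring.prime p \<Longrightarrow> p dvd order G \<Longrightarrow> p_part p x = p_part p y"
  shows "x = y"
proof -
  define z where "z = x \<otimes> inv y"
  have z: "z \<in> carrier G" using x y by (simp add: z_def)
  have "ord z = 1"
  proof (rule ccontr)
    assume "ord z \<noteq> 1"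
    then obtain p :: nat where p: "Factorial_Ring.prime p" "p dvd ord z"
      using prime_factor_nat by blast
    then have "p dvd order G"
      using ord_dvd_group_order[OF z] dvd_trans by blast
    then have "p_part p z = \<one>"
      using eq[OF p(1)] x y by (simp add: z_def p_part_mult[OF p(1)] p_part_inv[OF p(1)] p_part_closed[OF p(1)])
    then have "ord z dvd p'_order p"
      using p_part_eq_one_iff[OF p(1) z] z
      by (simp add: p'_subgroup_def power_kernel_def pow_eq_id)
    then show False
      using p not_dvd_p'_order dvd_trans by blast
  qed
  then have "z = \<one>" using z ord_eq_1 by blast
  then have "inv (inv y) = x"
    using x y by (intro inv_equality) (simp_all add: z_def)
  then show ?thesis
    using y by simp
qed

end

section \<open>Fixed points of coprime actions\<close>

text \<open>
  The action is written as a left action: in the application \<open>\<alpha> k n\<close> is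
  \<open>n\<^sup>j\<close> with \<open>j = k\<^sup>-\<^sup>1\<close>, the only form in which the action enters the definitions of crossed homomorphisms and
  of cohomologous ones.
\<close>

locale aut_action = J: group J + N: group N
  for J :: "('j, 'x) monoid_scheme" and N :: "('n, 'y) monoid_scheme" (structure) +
  fixes \<alpha> :: "'j \<Rightarrow> 'n \<Rightarrow> 'n"
  assumes hom: "k \<in> carrier J \<Longrightarrow> \<alpha> k \<in> hom N N"
    and act_one [simp]: "n \<in> carrier N \<Longrightarrow> \<alpha> \<one>\<^bsub>J\<^esub> n = n"
    and act_mult: "\<lbrakk>k \<in> carrier J; l \<in> carrier J; n \<in> carrier N\<rbrakk> \<Longrightarrow> \<alpha> (k \<otimes>\<^bsub>J\<^esub> l) n = \<alpha> k (\<alpha> l n)"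
begin

lemma act_group_hom: "k \<in> carrier J \<Longrightarrow> group_hom N N (\<alpha> k)"
  using hom by unfold_locales auto

lemma act_closed [simp]: "\<lbrakk>k \<in> carrier J; n \<in> carrier N\<rbrakk> \<Longrightarrow> \<alpha> k n \<in> carrier N"
  using hom hom_in_carrier by metis

lemma act_dist [simp]:
  "\<lbrakk>k \<in> carrier J; m \<in> carrier N; n \<in> carrier N\<rbrakk> \<Longrightarrow> \<alpha> k (m \<otimes> n) = \<alpha> k m \<otimes> \<alpha> k n"
  using hom hom_mult by metis

lemma act_id [simp]: "k \<in> carrier J \<Longrightarrow> \<alpha> k \<one> = \<one>"
  by (rule group_hom.hom_one[OF act_group_hom])

lemma act_inv [simp]: "\<lbrakk>k \<in> carrier J; n \<in> carrier N\<rbrakk> \<Longrightarrow> \<alpha> k (inv n) = inv (\<alpha> k n)"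
  by (rule group_hom.hom_inv[OF act_group_hom])

lemma act_pow: "\<lbrakk>k \<in> carrier J; n \<in> carrier N\<rbrakk> \<Longrightarrow> \<alpha> k (n [^] (r :: nat)) = \<alpha> k n [^] r"
  by (rule group_hom.hom_nat_pow[OF act_group_hom])

end

locale coprime_transitive_action = aut_action Q M \<alpha>
  for Q :: "('q, 'x) monoid_scheme" and M :: "('m, 'y) monoid_scheme" (structure) and \<alpha> +
  fixes \<Omega> :: "'o set" and \<beta> :: "'q \<Rightarrow> 'o \<Rightarrow> 'o" and \<mu> :: "'m \<Rightarrow> 'o \<Rightarrow> 'o"
  assumes nilpotent: "nilpotent_group M"
    and finite_Q: "finite (carrier Q)" and finite_M: "finite (carrier M)"
    and coprime_orders: "coprime (order Q) (order M)"
    and nonempty: "\<Omega> \<noteq> {}"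
    and \<beta>_closed: "\<lbrakk>j \<in> carrier Q; \<omega> \<in> \<Omega>\<rbrakk> \<Longrightarrow> \<beta> j \<omega> \<in> \<Omega>"
    and \<beta>_mult: "\<lbrakk>j \<in> carrier Q; k \<in> carrier Q; \<omega> \<in> \<Omega>\<rbrakk> \<Longrightarrow> \<beta> (j \<otimes>\<^bsub>Q\<^esub> k) \<omega> = \<beta> j (\<beta> k \<omega>)"
    and \<mu>_closed [simp]: "\<lbrakk>m \<in> carrier M; \<omega> \<in> \<Omega>\<rbrakk> \<Longrightarrow> \<mu> m \<omega> \<in> \<Omega>"
    and \<mu>_one [simp]: "\<omega> \<in> \<Omega> \<Longrightarrow> \<mu> \<one> \<omega> = \<omega>"
    and \<mu>_mult: "\<lbrakk>m \<in> carrier M; n \<in> carrier M; \<omega> \<in> \<Omega>\<rbrakk> \<Longrightarrow> \<mu> (m \<otimes> n) \<omega> = \<mu> m (\<mu> n \<omega>)"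
    and transitive: "\<lbrakk>\<omega> \<in> \<Omega>; \<omega>' \<in> \<Omega>\<rbrakk> \<Longrightarrow> \<exists>m\<in>carrier M. \<omega>' = \<mu> m \<omega>"
    and compatible: "\<lbrakk>j \<in> carrier Q; m \<in> carrier M; \<omega> \<in> \<Omega>\<rbrakk> \<Longrightarrow> \<beta> j (\<mu> m \<omega>) = \<mu> (\<alpha> j m) (\<beta> j \<omega>)"
begin

text \<open>
  Let \<open>A \<supseteq> B\<close> be consecutive terms of the lower central series and write \<open>\<beta> j \<omega> = z\<^sub>j \<omega>\<close> with
  \<open>z\<^sub>j \<in> A\<close>. The element \<open>z\<^sub>j\<close> is only determined up to the stabilizer of \<open>\<omega>\<close>, so one works modulo the
  subgroup \<open>S\<close> of all \<open>s \<in> A\<close> that move \<open>\<omega>\<close> within its \<open>B\<close>-orbit. Since \<open>A\<close> is central modulo \<open>B\<close>, the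
  subgroup \<open>S\<close> is normal and \<open>A/S\<close> is abelian. There \<open>z\<close> is a crossed homomorphism, and the product
  \<open>t\<close> of its values satisfies \<open>t = (\<alpha> j t) z\<^sub>j\<^sup>q\<close> for \<open>q = |Q|\<close>. With \<open>r\<close> inverse to \<open>q\<close> modulo \<open>|M|\<close>, the element
  \<open>w = t\<^sup>r\<close> satisfies \<open>w = (\<alpha> j w) z\<^sub>j\<close> modulo \<open>S\<close>, which says that \<open>w \<omega>\<close> is moved by \<open>Q\<close> only
  within its \<open>B\<close>-orbit.
\<close>

lemma almost_fixed_point_step:
  assumes \<omega>: "\<omega> \<in> \<Omega>"
    and moved: "\<And>j. j \<in> carrier Q \<Longrightarrow> \<exists>z\<in>lower_central_series M i. \<beta> j \<omega> = \<mu> z \<omega>"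
  shows "\<exists>\<omega>'\<in>\<Omega>. \<forall>j\<in>carrier Q. \<exists>z\<in>lower_central_series M (Suc i). \<beta> j \<omega>' = \<mu> z \<omega>'"
proof -
  define A where "A = lower_central_series M i"
  define B where "B = lower_central_series M (Suc i)"
  interpret A: normal A M unfolding A_def by (rule N.lower_central_series_normal)
  interpret B: normal B M unfolding B_def by (rule N.lower_central_series_normal)
  have BA: "B \<subseteq> A"
    unfolding A_def B_def by (rule N.lower_central_series_Suc_subset)
  have Ac: "a \<in> carrier M" if "a \<in> A" for a using that A.subset by blast
  have Bc: "b \<in> carrier M" if "b \<in> B" for b using that B.subset by blast
  have comm: "a \<otimes> g \<otimes> inv a \<otimes> inv g \<in> B" if "a \<in> A" "g \<in> carrier M" for a g
    using that unfolding A_def B_def by (rule N.commutator_in_lower_central_series)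
  have \<alpha>A: "\<alpha> j a \<in> A" if "j \<in> carrier Q" "a \<in> A" for j a
    using N.hom_lower_central_series[OF hom[OF that(1)]] that(2) by (simp add: A_def)
  have \<alpha>B: "\<alpha> j b \<in> B" if "j \<in> carrier Q" "b \<in> B" for j b
    using N.hom_lower_central_series[OF hom[OF that(1)]] that(2) by (simp only: B_def)
  obtain z where z: "\<And>j. j \<in> carrier Q \<Longrightarrow> z j \<in> A" "\<And>j. j \<in> carrier Q \<Longrightarrow> \<beta> j \<omega> = \<mu> (z j) \<omega>"
    using moved unfolding A_def by metis
  define S where "S = {s \<in> A. \<exists>b\<in>B. \<mu> s \<omega> = \<mu> b \<omega>}"
  have SA: "s \<in> A" if "s \<in> S" for s using that by (simp add: S_def)
  have Sc: "s \<in> carrier M" if "s \<in> S" for s using that SA Ac by blast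
  have BS: "b \<in> S" if "b \<in> B" for b
    unfolding S_def using that BA by (intro CollectI conjI bexI[of _ b]) auto
  have stab: "s \<in> S" if "s \<in> A" "\<mu> s \<omega> = \<omega>" for s
    unfolding S_def using that \<omega> by (intro CollectI conjI bexI[of _ \<one>] B.one_closed) simp_all
  have S_mult: "s \<otimes> t \<in> S" if st: "s \<in> S" "t \<in> S" for s t
  proof -
    obtain b where b: "b \<in> B" "\<mu> s \<omega> = \<mu> b \<omega>" using st(1) unfolding S_def by blast
    obtain c where c: "c \<in> B" "\<mu> t \<omega> = \<mu> c \<omega>" using st(2) unfolding S_def by blast
    have "\<mu> (s \<otimes> t) \<omega> = \<mu> (s \<otimes> c) \<omega>"
      using st c Sc Bc \<omega> by (simp add: \<mu>_mult)
    also have "s \<otimes> c = (s \<otimes> c \<otimes> inv s) \<otimes> s"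
      using Sc[OF st(1)] Bc[OF c(1)] by (simp only: N.word_simps)
    also have "\<mu> \<dots> \<omega> = \<mu> (s \<otimes> c \<otimes> inv s) (\<mu> b \<omega>)"
      using Sc[OF st(1)] Bc[OF c(1)] \<omega> b(2) by (subst \<mu>_mult) simp_all
    also have "\<dots> = \<mu> ((s \<otimes> c \<otimes> inv s) \<otimes> b) \<omega>"
      using Sc[OF st(1)] Bc[OF c(1)] Bc[OF b(1)] \<omega> by (subst \<mu>_mult) simp_all
    finally have "\<mu> (s \<otimes> t) \<omega> = \<mu> ((s \<otimes> c \<otimes> inv s) \<otimes> b) \<omega>" .
    moreover have "(s \<otimes> c \<otimes> inv s) \<otimes> b \<in> B"
      using b(1) c(1) Sc[OF st(1)] by (intro B.m_closed B.inv_op_closed2)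
    ultimately show ?thesis
      unfolding S_def by (intro CollectI conjI bexI A.m_closed SA st)
  qed
  have S_inv: "inv s \<in> S" if s: "s \<in> S" for s
  proof -
    obtain b where b: "b \<in> B" "\<mu> s \<omega> = \<mu> b \<omega>" using s unfolding S_def by blast
    have sb: "s \<in> carrier M" "b \<in> carrier M" using s b Sc Bc by auto
    have "\<mu> (inv b) (\<mu> s \<omega>) = \<omega>"
      using sb \<omega> by (simp add: b(2) \<mu>_mult[symmetric])
    then have "\<mu> (inv s) \<omega> = \<mu> (inv s) (\<mu> (inv b) (\<mu> s \<omega>))"
      by simp
    also have "\<dots> = \<mu> (inv s \<otimes> inv b \<otimes> s) \<omega>"
      using sb \<omega> by (simp add: \<mu>_mult)
    finally have "\<mu> (inv s) \<omega> = \<mu> (inv s \<otimes> inv b \<otimes> s) \<omega>" .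
    moreover have "inv s \<otimes> inv b \<otimes> s \<in> B"
      using b(1) sb by (intro B.inv_op_closed1 B.m_inv_closed)
    ultimately show ?thesis
      unfolding S_def by (intro CollectI conjI bexI A.m_inv_closed SA s)
  qed
  have S_conj: "g \<otimes> s \<otimes> inv g \<in> S" if s: "s \<in> S" and g: "g \<in> carrier M" for s g
  proof -
    have "g \<otimes> s \<otimes> inv g = inv (s \<otimes> g \<otimes> inv s \<otimes> inv g) \<otimes> s"
      using g Sc[OF s] by (simp only: N.word_simps)
    then show ?thesis
      using s g comm SA BS B.m_inv_closed by (simp add: S_mult)
  qed
  have S_sub: "subgroup S M"
    using Sc BS[OF B.one_closed] S_mult S_inv by (intro N.subgroupI) auto
  interpret S: normal S M
    using S_conj by (intro N.normal_invI S_sub)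
  interpret MS: group "M Mod S" by (rule S.factorgroup_is_group)
  define h where "h = (\<lambda>a. S #> a)"
  interpret h: group_hom M "M Mod S" h
    unfolding h_def using S.r_coset_hom_Mod
    by (simp add: group_hom_def group_hom_axioms_def)
  have h_eq: "h a = h b \<longleftrightarrow> inv b \<otimes> a \<in> S" if ab: "a \<in> carrier M" "b \<in> carrier M" for a b
  proof -
    have "h a = h b \<longleftrightarrow> h (inv b \<otimes> a) = \<one>\<^bsub>M Mod S\<^esub>"
      using ab MS.inv_solve_left[of "\<one>\<^bsub>M Mod S\<^esub>" "h b" "h a"]
      by (auto simp: MS.r_one simp del: one_FactGroup mult_FactGroup)
    also have "\<dots> \<longleftrightarrow> inv b \<otimes> a \<in> S"
      using ab N.coset_join1[OF _ _ S_sub] N.coset_join2[OF _ S_sub]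
      by (auto simp: h_def FactGroup_def)
    finally show ?thesis .
  qed
  have h_stab: "h a = h b" if ab: "a \<in> A" "b \<in> A" "\<mu> a \<omega> = \<mu> b \<omega>" for a b
  proof -
    have "\<mu> (inv b \<otimes> a) \<omega> = \<mu> (inv b) (\<mu> b \<omega>)"
      using ab Ac \<omega> by (simp add: \<mu>_mult)
    also have "\<dots> = \<omega>"
      using ab Ac \<omega> by (simp add: \<mu>_mult[symmetric])
    finally have "inv b \<otimes> a \<in> S"
      using ab by (intro stab A.m_closed A.m_inv_closed)
    then show ?thesis using h_eq ab Ac by simp
  qed
  have h_comm: "h a \<otimes>\<^bsub>M Mod S\<^esub> h b = h b \<otimes>\<^bsub>M Mod S\<^esub> h a" if ab: "a \<in> A" "b \<in> A" for a b
  proof -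
    have c: "a \<in> carrier M" "b \<in> carrier M" using ab Ac by auto
    have "inv (b \<otimes> a) \<otimes> (a \<otimes> b) = inv a \<otimes> inv b \<otimes> inv (inv a) \<otimes> inv (inv b)"
      using c by (simp only: N.word_simps)
    also have "\<dots> \<in> S"
      using ab c by (intro BS comm A.m_inv_closed N.inv_closed)
    finally have "h (a \<otimes> b) = h (b \<otimes> a)"
      using c by (simp only: h_eq N.m_closed)
    then show ?thesis using c by simp
  qed
  define H where "H = (M Mod S)\<lparr>carrier := h ` A\<rparr>"
  have H_sub: "subgroup (h ` A) (M Mod S)"
    by (rule h.subgroup_img_is_subgroup[OF A.subgroup_axioms])
  interpret H: comm_group H
  proof -
    have "group H"
      unfolding H_def by (rule MS.subgroup_imp_group[OF H_sub])
    then show "comm_group H"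
      by (rule group.group_comm_groupI) (auto simp: H_def h_comm simp del: mult_FactGroup)
  qed
  have hA: "h a \<in> carrier H" if "a \<in> A" for a using that by (simp add: H_def)
  have h_mult: "h (a \<otimes> b) = h a \<otimes>\<^bsub>H\<^esub> h b" if "a \<in> A" "b \<in> A" for a b
    using that Ac by (simp add: H_def)
  have h_one: "h \<one> = \<one>\<^bsub>H\<^esub>"
    using h.hom_one by (simp add: H_def)
  note h.hom_mult [simp del] h.hom_one [simp del]
  have A_pow: "a [^] (n :: nat) \<in> A" if "a \<in> A" for a n
    using N.subgroup_nat_pow_closed[OF A.subgroup_axioms that] .
  have h_pow: "h (a [^] (n :: nat)) = h a [^]\<^bsub>H\<^esub> n" if "a \<in> A" for a n
    by (induct n) (use that A_pow in \<open>simp_all add: h_one h_mult\<close>)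
  \<comment> \<open>Both factorizations of the action of \<open>j k\<close> send \<open>\<omega>\<close> to the same point, so the displacements
     differ by an element of the stabilizer of \<open>\<omega>\<close>, which lies in \<open>S\<close>.\<close>
  have cocycle: "h (z (j \<otimes>\<^bsub>Q\<^esub> k)) = h (\<alpha> j (z k)) \<otimes>\<^bsub>H\<^esub> h (z j)"
    if jk: "j \<in> carrier Q" "k \<in> carrier Q" for j k
  proof -
    have "\<mu> (z (j \<otimes>\<^bsub>Q\<^esub> k)) \<omega> = \<beta> j (\<beta> k \<omega>)"
      using jk z(2)[of "j \<otimes>\<^bsub>Q\<^esub> k"] \<omega> by (simp add: \<beta>_mult)
    also have "\<dots> = \<mu> (\<alpha> j (z k)) (\<mu> (z j) \<omega>)"
      using jk z Ac \<omega> by (simp add: compatible)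
    also have "\<dots> = \<mu> (\<alpha> j (z k) \<otimes> z j) \<omega>"
      using jk z Ac \<omega> by (simp add: \<mu>_mult)
    finally have "h (z (j \<otimes>\<^bsub>Q\<^esub> k)) = h (\<alpha> j (z k) \<otimes> z j)"
      using jk z(1) \<alpha>A by (intro h_stab) (auto intro: A.m_closed)
    then show ?thesis
      using jk z(1) \<alpha>A h_mult by simp
  qed
  \<comment> \<open>The product of the classes of the \<open>\<alpha> j (z k)\<close> is represented by one \<open>t\<close> for all \<open>j\<close>
     simultaneously, so that \<open>\<alpha> j\<close> need not be defined on the quotient.\<close>
  have partial: "\<exists>t\<in>A. \<forall>j\<in>carrier Q. finprod H (\<lambda>k. h (\<alpha> j (z k))) F = h (\<alpha> j t)"
    if "finite F" "F \<subseteq> carrier Q" for F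
    using that
  proof (induct F rule: finite_induct)
    case empty
    show ?case
      by (rule bexI[of _ \<one>]) (simp_all add: h_one)
  next
    case (insert k F)
    then obtain t where t: "t \<in> A" "\<forall>j\<in>carrier Q. finprod H (\<lambda>k. h (\<alpha> j (z k))) F = h (\<alpha> j t)"
      by auto
    have "finprod H (\<lambda>k. h (\<alpha> j (z k))) (insert k F) = h (\<alpha> j (z k \<otimes> t))" if j: "j \<in> carrier Q" for j
    proof -
      have "finprod H (\<lambda>k. h (\<alpha> j (z k))) (insert k F)
          = h (\<alpha> j (z k)) \<otimes>\<^bsub>H\<^esub> finprod H (\<lambda>k. h (\<alpha> j (z k))) F"
        using insert j z(1) \<alpha>A hA by (intro H.finprod_insert) auto
      then show ?thesis
        using insert(4) j t z(1) \<alpha>A Ac by (simp add: h_mult)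
    qed
    moreover have "z k \<otimes> t \<in> A"
      using insert(4) t z(1) A.m_closed by auto
    ultimately show ?case by blast
  qed
  obtain t where t: "t \<in> A"
    and ft: "\<And>j. j \<in> carrier Q \<Longrightarrow> finprod H (\<lambda>k. h (\<alpha> j (z k))) (carrier Q) = h (\<alpha> j t)"
    using partial[OF finite_Q subset_refl] by metis
  have average: "h t = h (\<alpha> j t) \<otimes>\<^bsub>H\<^esub> h (z j) [^]\<^bsub>H\<^esub> order Q" if j: "j \<in> carrier Q" for j
  proof -
    have bij: "(\<lambda>k. j \<otimes>\<^bsub>Q\<^esub> k) ` carrier Q = carrier Q"
      using J.surj_const_mult[OF j] .
    have "h t = finprod H (\<lambda>k. h (\<alpha> \<one>\<^bsub>Q\<^esub> (z k))) (carrier Q)"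
      using ft[of "\<one>\<^bsub>Q\<^esub>"] t Ac by simp
    also have "\<dots> = finprod H (\<lambda>k. h (z k)) (carrier Q)"
      using z(1) Ac hA by (intro H.finprod_cong') auto
    also have "\<dots> = finprod H (\<lambda>k. h (z (j \<otimes>\<^bsub>Q\<^esub> k))) (carrier Q)"
      using H.finprod_reindex[of "\<lambda>k. h (z k)" "\<lambda>k. j \<otimes>\<^bsub>Q\<^esub> k" "carrier Q"]
        z(1) hA J.inj_on_cmult[OF j] unfolding bij by auto
    also have "\<dots> = finprod H (\<lambda>k. h (\<alpha> j (z k)) \<otimes>\<^bsub>H\<^esub> h (z j)) (carrier Q)"
      using z(1) hA \<alpha>A j by (intro H.finprod_cong') (auto simp: cocycle)
    also have "\<dots> = finprod H (\<lambda>k. h (\<alpha> j (z k))) (carrier Q) \<otimes>\<^bsub>H\<^esub> finprod H (\<lambda>k. h (z j)) (carrier Q)"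
      using z(1) hA \<alpha>A j by (intro H.finprod_multf) auto
    also have "\<dots> = h (\<alpha> j t) \<otimes>\<^bsub>H\<^esub> h (z j) [^]\<^bsub>H\<^esub> order Q"
      using ft[OF j] H.finprod_const[OF hA[OF z(1)[OF j]], of "carrier Q"] by (simp add: order_def)
    finally show ?thesis .
  qed
  obtain r where r: "[r * order Q = 1] (mod order M)"
    using cong_solve_coprime_nat[OF coprime_orders] by (metis mult.commute One_nat_def)
  define w where "w = t [^] r"
  have w: "w \<in> A" using A_pow t by (simp add: w_def)
  have hw: "h w = h (\<alpha> j w \<otimes> z j)" if j: "j \<in> carrier Q" for j
  proof -
    have zj: "z j [^] (order Q * r) = z j"
      using r Ac[OF z(1)[OF j]] N.pow_order_eq_1 N.order_gt_0_iff_finite finite_M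
      by (intro N.pow_cong_one[of _ "order M"]) (auto simp: mult.commute)
    have "h w = h t [^]\<^bsub>H\<^esub> r"
      using t by (simp add: w_def h_pow)
    also have "\<dots> = h (\<alpha> j t) [^]\<^bsub>H\<^esub> r \<otimes>\<^bsub>H\<^esub> (h (z j) [^]\<^bsub>H\<^esub> order Q) [^]\<^bsub>H\<^esub> r"
      using average[OF j] hA \<alpha>A[OF j t] z(1)[OF j] by (simp add: H.nat_pow_distrib)
    also have "h (\<alpha> j t) [^]\<^bsub>H\<^esub> r = h (\<alpha> j w)"
      using \<alpha>A[OF j t] j t Ac by (simp add: w_def act_pow h_pow)
    also have "(h (z j) [^]\<^bsub>H\<^esub> order Q) [^]\<^bsub>H\<^esub> r = h (z j [^] (order Q * r))"
      using z(1)[OF j] hA by (simp only: H.nat_pow_pow h_pow)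
    also have "\<dots> = h (z j)"
      by (simp only: zj)
    also have "h (\<alpha> j w) \<otimes>\<^bsub>H\<^esub> h (z j) = h (\<alpha> j w \<otimes> z j)"
      using h_mult[OF \<alpha>A[OF j w] z(1)[OF j]] by simp
    finally show ?thesis .
  qed
  have "\<exists>b\<in>B. \<beta> j (\<mu> w \<omega>) = \<mu> b (\<mu> w \<omega>)" if j: "j \<in> carrier Q" for j
  proof -
    define s where "s = inv w \<otimes> (\<alpha> j w \<otimes> z j)"
    have c: "w \<in> carrier M" "z j \<in> carrier M" "\<alpha> j w \<in> carrier M" "s \<in> carrier M"
      using w z(1) j Ac by (auto simp: s_def)
    have "s \<in> S"
      unfolding s_def using h_eq[of "\<alpha> j w \<otimes> z j" w] hw[OF j] c by simp
    then obtain b where b: "b \<in> B" "\<mu> s \<omega> = \<mu> b \<omega>" unfolding S_def by blast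
    have bc: "b \<in> carrier M" using b Bc by simp
    have "\<beta> j (\<mu> w \<omega>) = \<mu> (\<alpha> j w \<otimes> z j) \<omega>"
      using j c \<omega> z(2) by (simp add: compatible \<mu>_mult)
    also have "\<alpha> j w \<otimes> z j = w \<otimes> s"
      using c by (simp only: s_def N.word_simps)
    also have "\<mu> (w \<otimes> s) \<omega> = \<mu> (w \<otimes> b) \<omega>"
      using c bc \<omega> b(2) by (simp add: \<mu>_mult)
    also have "w \<otimes> b = (w \<otimes> b \<otimes> inv w) \<otimes> w"
      using c bc by (simp only: N.word_simps)
    also have "\<mu> \<dots> \<omega> = \<mu> (w \<otimes> b \<otimes> inv w) (\<mu> w \<omega>)"
      using c bc \<omega> by (subst \<mu>_mult) simp_all
    finally show ?thesis
      using B.inv_op_closed2[OF c(1) b(1)] by blast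
  qed
  then show ?thesis
    using w Ac \<omega> \<mu>_closed unfolding B_def by blast
qed

theorem fixed_point_exists: "\<exists>\<omega>\<in>\<Omega>. \<forall>j\<in>carrier Q. \<beta> j \<omega> = \<omega>"
proof -
  have "\<exists>\<omega>\<in>\<Omega>. \<forall>j\<in>carrier Q. \<exists>z\<in>lower_central_series M i. \<beta> j \<omega> = \<mu> z \<omega>" for i
  proof (induct i)
    case 0
    obtain \<omega> where "\<omega> \<in> \<Omega>" using nonempty by blast
    then show ?case using transitive \<beta>_closed by (intro bexI[of _ \<omega>]) auto
  next
    case (Suc i)
    then show ?case using almost_fixed_point_step by blast
  qed
  moreover obtain i where "lower_central_series M i = {\<one>}"
    using nilpotent unfolding nilpotent_group_def by blast
  ultimately show ?thesis
    by (metis \<mu>_one singletonD)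
qed

end

section \<open>Crossed homomorphisms on subgroups\<close>

context aut_action
begin

text \<open>
  The predicates below refer only to the values on \<open>S\<close>, which may be any subset, so that one function
  can be considered on \<open>J\<close> and on its subgroups without restricting it.
\<close>

definition cocycle :: "'j set \<Rightarrow> ('j \<Rightarrow> 'n) \<Rightarrow> bool" where
  "cocycle S f \<longleftrightarrow> (\<forall>k\<in>S. f k \<in> carrier N) \<and>
     (\<forall>k\<in>S. \<forall>l\<in>S. f (k \<otimes>\<^bsub>J\<^esub> l) = f k \<otimes> \<alpha> k (f l))"

definition twist :: "'n \<Rightarrow> ('j \<Rightarrow> 'n) \<Rightarrow> 'j \<Rightarrow> 'n" where
  "twist n f k = inv n \<otimes> f k \<otimes> \<alpha> k n"

definition cohom :: "'j set \<Rightarrow> ('j \<Rightarrow> 'n) \<Rightarrow> ('j \<Rightarrow> 'n) \<Rightarrow> bool" where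
  "cohom S f g \<longleftrightarrow> (\<exists>n\<in>carrier N. \<forall>k\<in>S. g k = twist n f k)"

text \<open>
  For crossed homomorphisms \<open>f\<close> and \<open>g\<close> this is an action on the set \<open>N\<close> whose fixed points are the elements
  turning \<open>f\<close> into \<open>g\<close> (\<open>shift_mult\<close>, \<open>shift_fixed_iff\<close>). For \<open>f = g\<close> it is an action by
  automorphisms, the given one twisted by \<open>g\<close>, and by \<open>shift_dist\<close> it governs how the general
  case changes under right multiplication.
\<close>

definition shift :: "('j \<Rightarrow> 'n) \<Rightarrow> ('j \<Rightarrow> 'n) \<Rightarrow> 'j \<Rightarrow> 'n \<Rightarrow> 'n" where
  "shift f g k n = f k \<otimes> \<alpha> k n \<otimes> inv (g k)"

lemma cocycle_closed: "\<lbrakk>cocycle S f; k \<in> S\<rbrakk> \<Longrightarrow> f k \<in> carrier N"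
  by (simp add: cocycle_def)

lemma cocycle_mult: "\<lbrakk>cocycle S f; k \<in> S; l \<in> S\<rbrakk> \<Longrightarrow> f (k \<otimes>\<^bsub>J\<^esub> l) = f k \<otimes> \<alpha> k (f l)"
  by (simp add: cocycle_def)

lemma cocycle_subset: "\<lbrakk>cocycle S f; T \<subseteq> S\<rbrakk> \<Longrightarrow> cocycle T f"
  unfolding cocycle_def by (simp add: subset_iff)

lemma cocycle_one:
  assumes "subgroup S J" "cocycle S f"
  shows "f \<one>\<^bsub>J\<^esub> = \<one>"
proof -
  have o: "\<one>\<^bsub>J\<^esub> \<in> S" by (rule subgroup.one_closed[OF assms(1)])
  then have "f \<one>\<^bsub>J\<^esub> = f \<one>\<^bsub>J\<^esub> \<otimes> f \<one>\<^bsub>J\<^esub>"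
    using cocycle_mult[OF assms(2) o o] cocycle_closed[OF assms(2) o] by simp
  then show ?thesis
    using cocycle_closed[OF assms(2) o] N.l_cancel_one by metis
qed

lemma twist_closed [simp]:
  "\<lbrakk>n \<in> carrier N; k \<in> carrier J; f k \<in> carrier N\<rbrakk> \<Longrightarrow> twist n f k \<in> carrier N"
  by (simp add: twist_def)

lemma twist_one [simp]:
  "\<lbrakk>k \<in> carrier J; f k \<in> carrier N\<rbrakk> \<Longrightarrow> twist \<one> f k = f k"
  by (simp add: twist_def)

lemma twist_mult:
  assumes "n \<in> carrier N" "m \<in> carrier N" "k \<in> carrier J" "f k \<in> carrier N"
  shows "twist (n \<otimes> m) f k = twist m (twist n f) k"
  using assms by (simp only: twist_def act_dist act_closed N.word_simps)

lemma cocycle_twist: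
  assumes S: "subgroup S J" and f: "cocycle S f" and n: "n \<in> carrier N"
  shows "cocycle S (twist n f)"
  unfolding cocycle_def
proof (intro conjI ballI)
  fix k l assume kl: "k \<in> S" "l \<in> S"
  have c: "k \<in> carrier J" "l \<in> carrier J" "f k \<in> carrier N" "f l \<in> carrier N"
    using kl subgroup.subset[OF S] f by (auto simp: cocycle_closed)
  show "twist n f k \<in> carrier N"
    using c n by simp
  show "twist n f (k \<otimes>\<^bsub>J\<^esub> l) = twist n f k \<otimes> \<alpha> k (twist n f l)"
    using c n by (simp only: twist_def cocycle_mult[OF f kl] act_mult act_dist act_inv act_closed N.word_simps)
qed

lemma cohom_refl:
  assumes "subgroup S J" "cocycle S f" "\<And>k. k \<in> S \<Longrightarrow> g k = f k"
  shows "cohom S f g"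
  unfolding cohom_def
  using assms subgroup.subset[OF assms(1)]
  by (intro bexI[of _ \<one>]) (auto simp: cocycle_closed subset_iff)

lemma cohom_trans:
  assumes S: "subgroup S J" and f: "cocycle S f" and "cohom S f g" "cohom S g h"
  shows "cohom S f h"
proof -
  obtain n where n: "n \<in> carrier N" "\<And>k. k \<in> S \<Longrightarrow> g k = twist n f k"
    using assms(3) unfolding cohom_def by blast
  obtain m where m: "m \<in> carrier N" "\<And>k. k \<in> S \<Longrightarrow> h k = twist m g k"
    using assms(4) unfolding cohom_def by blast
  have "h k = twist (n \<otimes> m) f k" if k: "k \<in> S" for k
  proof -
    have c: "k \<in> carrier J" "f k \<in> carrier N"
      using k subgroup.subset[OF S] f by (auto simp: cocycle_closed)
    have "h k = twist m (twist n f) k"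
      using m(2)[OF k] n(2)[OF k] by (simp add: twist_def)
    then show ?thesis using twist_mult n m c by simp
  qed
  then show ?thesis
    unfolding cohom_def using n m by (intro bexI[of _ "n \<otimes> m"]) auto
qed

lemma cohom_sym:
  assumes S: "subgroup S J" and f: "cocycle S f" and "cohom S f g"
  shows "cohom S g f"
proof -
  obtain n where n: "n \<in> carrier N" "\<And>k. k \<in> S \<Longrightarrow> g k = twist n f k"
    using assms(3) unfolding cohom_def by blast
  have "f k = twist (inv n) g k" if k: "k \<in> S" for k
  proof -
    have c: "k \<in> carrier J" "f k \<in> carrier N"
      using k subgroup.subset[OF S] f by (auto simp: cocycle_closed)
    then show ?thesis
      using n(1) n(2)[OF k] by (simp only: twist_def act_inv act_closed N.word_simps)
  qed
  then show ?thesis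
    unfolding cohom_def using n by (intro bexI[of _ "inv n"]) auto
qed

lemma cohom_subset: "\<lbrakk>cohom S f g; T \<subseteq> S\<rbrakk> \<Longrightarrow> cohom T f g"
  unfolding cohom_def by blast

lemma shift_closed [simp]:
  "\<lbrakk>k \<in> carrier J; f k \<in> carrier N; g k \<in> carrier N; n \<in> carrier N\<rbrakk> \<Longrightarrow> shift f g k n \<in> carrier N"
  by (simp add: shift_def)

lemma shift_fixed_iff:
  assumes "k \<in> carrier J" "f k \<in> carrier N" "g k \<in> carrier N" "n \<in> carrier N"
  shows "shift f g k n = n \<longleftrightarrow> g k = twist n f k"
proof
  assume "shift f g k n = n"
  then have "inv n \<otimes> shift f g k n \<otimes> g k = inv n \<otimes> n \<otimes> g k"
    by simp
  then show "g k = twist n f k"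
    using assms by (simp only: shift_def twist_def act_closed N.word_simps)
next
  assume "g k = twist n f k"
  then show "shift f g k n = n"
    using assms by (simp only: shift_def twist_def act_closed N.word_simps)
qed

lemma shift_mult:
  assumes S: "subgroup S J" and f: "cocycle S f" and g: "cocycle S g"
    and kl: "k \<in> S" "l \<in> S" and n: "n \<in> carrier N"
  shows "shift f g (k \<otimes>\<^bsub>J\<^esub> l) n = shift f g k (shift f g l n)"
proof -
  have c: "k \<in> carrier J" "l \<in> carrier J" "f k \<in> carrier N" "f l \<in> carrier N"
      "g k \<in> carrier N" "g l \<in> carrier N"
    using kl subgroup.subset[OF S] f g by (auto simp: cocycle_closed)
  then show ?thesis
    using n by (simp only: shift_def cocycle_mult[OF f kl] cocycle_mult[OF g kl]
        act_mult act_dist act_inv act_closed N.word_simps)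
qed

lemma shift_dist:
  assumes "k \<in> carrier J" "f k \<in> carrier N" "g k \<in> carrier N" "n \<in> carrier N" "c \<in> carrier N"
  shows "shift f g k (n \<otimes> c) = shift f g k n \<otimes> shift g g k c"
  using assms by (simp only: shift_def act_dist act_closed N.word_simps)

text \<open>
  The fixed point theorem for the coset \<open>n0 C\<close>, on which \<open>C\<close> acts transitively by right
  multiplication and \<open>S\<close> by \<open>shift f g\<close>. The last assumption says that \<open>S\<close> preserves
  this coset; by \<open>shift_dist\<close> the twisted action \<open>shift g g\<close> then preserves \<open>C\<close>.
\<close>

lemma coprime_coset_cohomologous:
  assumes nil: "nilpotent_group N" and finN: "finite (carrier N)"
    and S: "subgroup S J" and finS: "finite S"
    and f: "cocycle S f" and g: "cocycle S g"
    and C: "subgroup C N" and cop: "coprime (card S) (card C)"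
    and n0: "n0 \<in> carrier N"
    and inv: "\<And>k c. \<lbrakk>k \<in> S; c \<in> C\<rbrakk> \<Longrightarrow> inv n0 \<otimes> shift f g k (n0 \<otimes> c) \<in> C"
  shows "\<exists>c\<in>C. \<forall>k\<in>S. g k = twist (n0 \<otimes> c) f k"
proof -
  interpret C: subgroup C N by (rule C)
  have Sc: "k \<in> carrier J" if "k \<in> S" for k using that subgroup.subset[OF S] by blast
  have fg: "f k \<in> carrier N" "g k \<in> carrier N" if "k \<in> S" for k
    using that f g by (auto simp: cocycle_closed)
  have Cc: "c \<in> carrier N" if "c \<in> C" for c using that C.subset by blast
  have \<delta>C: "shift g g k c \<in> C" if kc: "k \<in> S" "c \<in> C" for k c
  proof -
    have "inv (inv n0 \<otimes> shift f g k (n0 \<otimes> \<one>)) \<otimes> (inv n0 \<otimes> shift f g k (n0 \<otimes> c)) \<in> C"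
      using kc by (intro C.m_closed C.m_inv_closed inv C.one_closed)
    also have "inv (inv n0 \<otimes> shift f g k (n0 \<otimes> \<one>)) \<otimes> (inv n0 \<otimes> shift f g k (n0 \<otimes> c)) = shift g g k c"
      using kc Sc fg Cc n0
      by (simp only: shift_dist N.r_one shift_closed N.word_simps)
    finally show ?thesis .
  qed
  interpret CA: coprime_transitive_action "J\<lparr>carrier := S\<rparr>" "N\<lparr>carrier := C\<rparr>" "shift g g"
    "(\<lambda>c. n0 \<otimes> c) ` C" "shift f g" "\<lambda>c n. n \<otimes> inv c"
  proof (intro coprime_transitive_action.intro aut_action.intro
      aut_action_axioms.intro coprime_transitive_action_axioms.intro)
    show "group (J\<lparr>carrier := S\<rparr>)" using S J.subgroup_imp_group by blast
    show "group (N\<lparr>carrier := C\<rparr>)" using C N.subgroup_imp_group by blast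
    show "nilpotent_group (N\<lparr>carrier := C\<rparr>)" using N.nilpotent_subgroup nil C by blast
    show "finite (carrier (J\<lparr>carrier := S\<rparr>))" using finS by simp
    show "finite (carrier (N\<lparr>carrier := C\<rparr>))"
      using finite_subset[OF C.subset finN] by simp
    show "coprime (order (J\<lparr>carrier := S\<rparr>)) (order (N\<lparr>carrier := C\<rparr>))"
      using cop by (simp add: order_def)
    show "(\<lambda>c. n0 \<otimes> c) ` C \<noteq> {}" using C.one_closed by blast
  next
    fix k assume k: "k \<in> carrier (J\<lparr>carrier := S\<rparr>)"
    show "shift g g k \<in> hom (N\<lparr>carrier := C\<rparr>) (N\<lparr>carrier := C\<rparr>)"
      using k \<delta>C Sc fg Cc by (auto simp: hom_def shift_dist)
    fix n assume n: "n \<in> (\<lambda>c. n0 \<otimes> c) ` C"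
    then obtain c where c: "c \<in> C" "n = n0 \<otimes> c" by blast
    have "shift f g k n = n0 \<otimes> (inv n0 \<otimes> shift f g k n)"
      using k Sc fg c Cc n0 by (simp add: N.cancel_left)
    then show "shift f g k n \<in> (\<lambda>c. n0 \<otimes> c) ` C"
      using inv[of k c] k c by (intro image_eqI[of _ _ "inv n0 \<otimes> shift f g k n"]) simp_all
  next
    fix c assume "c \<in> carrier (N\<lparr>carrier := C\<rparr>)"
    then show "shift g g \<one>\<^bsub>J\<lparr>carrier := S\<rparr>\<^esub> c = c"
      using Cc cocycle_one[OF S g] by (simp add: shift_def)
  next
    fix k l c assume "k \<in> carrier (J\<lparr>carrier := S\<rparr>)" "l \<in> carrier (J\<lparr>carrier := S\<rparr>)"
      "c \<in> carrier (N\<lparr>carrier := C\<rparr>)"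
    then show "shift g g (k \<otimes>\<^bsub>J\<lparr>carrier := S\<rparr>\<^esub> l) c = shift g g k (shift g g l c)"
      using shift_mult[OF S g g] Cc by simp
  next
    fix k l n assume "k \<in> carrier (J\<lparr>carrier := S\<rparr>)" "l \<in> carrier (J\<lparr>carrier := S\<rparr>)"
      "n \<in> (\<lambda>c. n0 \<otimes> c) ` C"
    then show "shift f g (k \<otimes>\<^bsub>J\<lparr>carrier := S\<rparr>\<^esub> l) n = shift f g k (shift f g l n)"
      using shift_mult[OF S f g] Cc n0 by auto
  next
    fix c n assume cn: "c \<in> carrier (N\<lparr>carrier := C\<rparr>)" "n \<in> (\<lambda>c. n0 \<otimes> c) ` C"
    then obtain d where d: "d \<in> C" "n = n0 \<otimes> d" by blast
    have "n \<otimes> inv c = n0 \<otimes> (d \<otimes> inv c)"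
      using cn d Cc n0 by (simp add: N.m_assoc)
    moreover have "d \<otimes> inv c \<in> C"
      using cn d by simp
    ultimately show "n \<otimes> inv c \<in> (\<lambda>c. n0 \<otimes> c) ` C" by blast
  next
    fix n assume "n \<in> (\<lambda>c. n0 \<otimes> c) ` C"
    then show "n \<otimes> inv \<one>\<^bsub>N\<lparr>carrier := C\<rparr>\<^esub> = n" using Cc n0 by auto
  next
    fix c d n assume "c \<in> carrier (N\<lparr>carrier := C\<rparr>)" "d \<in> carrier (N\<lparr>carrier := C\<rparr>)"
      "n \<in> (\<lambda>c. n0 \<otimes> c) ` C"
    then have "c \<in> carrier N" "d \<in> carrier N" "n \<in> carrier N"
      using Cc n0 by auto
    then show "n \<otimes> inv (c \<otimes>\<^bsub>N\<lparr>carrier := C\<rparr>\<^esub> d) = n \<otimes> inv d \<otimes> inv c"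
      by (simp add: N.m_assoc N.inv_mult_group)
  next
    fix n m assume "n \<in> (\<lambda>c. n0 \<otimes> c) ` C" "m \<in> (\<lambda>c. n0 \<otimes> c) ` C"
    then obtain c d where cd: "c \<in> C" "n = n0 \<otimes> c" "d \<in> C" "m = n0 \<otimes> d" by blast
    have "m = n \<otimes> inv (inv d \<otimes> c)"
      using cd(1,3) Cc[OF cd(1)] Cc[OF cd(3)] n0 unfolding cd(2,4)
      by (simp only: N.word_simps)
    moreover have "inv d \<otimes> c \<in> C"
      using cd by simp
    ultimately show "\<exists>c\<in>carrier (N\<lparr>carrier := C\<rparr>). m = n \<otimes> inv c" by auto
  next
    fix k c n assume k: "k \<in> carrier (J\<lparr>carrier := S\<rparr>)" and c: "c \<in> carrier (N\<lparr>carrier := C\<rparr>)"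
      and n: "n \<in> (\<lambda>c. n0 \<otimes> c) ` C"
    have "n \<in> carrier N" using n Cc n0 by auto
    then show "shift f g k (n \<otimes> inv c) = shift f g k n \<otimes> inv (shift g g k c)"
      using k c Sc[of k] fg[of k] Cc[of c]
      by (simp add: shift_def N.word_simps)
  qed
  obtain n where n: "n \<in> (\<lambda>c. n0 \<otimes> c) ` C" "\<And>k. k \<in> S \<Longrightarrow> shift f g k n = n"
    using CA.fixed_point_exists by auto
  obtain c where c: "c \<in> C" "n = n0 \<otimes> c" using n(1) by blast
  have "g k = twist n f k" if k: "k \<in> S" for k
    using shift_fixed_iff[of k f g n] n(2)[OF k] Sc[OF k] fg[OF k] Cc[OF c(1)] n0 c(2) by simp
  then show ?thesis using c by blast
qed

end

section \<open>One prime at a time\<close>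

locale nilpotent_action = aut_action J N \<alpha> + J: finite_nilpotent_group J + N: finite_nilpotent_group N
  for J :: "('j, 'x) monoid_scheme" and N :: "('n, 'y) monoid_scheme" (structure) and \<alpha>
begin

context
  fixes p :: nat
  assumes p: "Factorial_Ring.prime p"
begin

lemma act_p_part: "\<lbrakk>k \<in> carrier J; n \<in> carrier N\<rbrakk> \<Longrightarrow> \<alpha> k (N.p_part p n) = N.p_part p (\<alpha> k n)"
  using N.p_part_endo[OF p hom] by blast

lemma act_p_subgroup:
  assumes "k \<in> carrier J" "n \<in> N.p_subgroup p"
  shows "\<alpha> k n \<in> N.p_subgroup p"
  using act_p_part[OF assms(1), of n] N.p_part_in_p_subgroup[OF p, of "\<alpha> k n"] assms
    N.p_part_p_subgroup[OF p assms(2)] N.p_subgroup_closed[OF p assms(2)] by simp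

lemma p_part_twist:
  assumes "n \<in> carrier N" "k \<in> carrier J" "f k \<in> carrier N"
  shows "N.p_part p (twist n f k) = twist (N.p_part p n) (\<lambda>k. N.p_part p (f k)) k"
  using assms
  by (simp add: twist_def N.p_part_mult[OF p] N.p_part_inv[OF p] act_p_part)

lemma cocycle_p_part:
  assumes S: "subgroup S J" and f: "cocycle S f"
  shows "cocycle S (\<lambda>k. N.p_part p (f k))"
  unfolding cocycle_def
proof (intro conjI ballI)
  fix k l assume kl: "k \<in> S" "l \<in> S"
  have c: "k \<in> carrier J" "f k \<in> carrier N" "f l \<in> carrier N"
    using kl subgroup.subset[OF S] f by (auto simp: cocycle_closed)
  show "N.p_part p (f k) \<in> carrier N"
    using c N.p_part_closed[OF p] by simp
  show "N.p_part p (f (k \<otimes>\<^bsub>J\<^esub> l)) = N.p_part p (f k) \<otimes> \<alpha> k (N.p_part p (f l))"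
    using c by (simp add: cocycle_mult[OF f kl] act_p_part N.p_part_mult[OF p])
qed

lemma cohom_p_part:
  assumes S: "subgroup S J" and f: "cocycle S f" and "cohom S f g"
  shows "\<exists>n\<in>N.p_subgroup p. \<forall>k\<in>S. N.p_part p (g k) = twist n (\<lambda>k. N.p_part p (f k)) k"
proof -
  obtain n where n: "n \<in> carrier N" "\<And>k. k \<in> S \<Longrightarrow> g k = twist n f k"
    using assms(3) unfolding cohom_def by blast
  have "N.p_part p (g k) = twist (N.p_part p n) (\<lambda>k. N.p_part p (f k)) k" if k: "k \<in> S" for k
    using n(2)[OF k] p_part_twist[OF n(1), of k f] subgroup.subset[OF S] cocycle_closed[OF f k] k
    by auto
  then show ?thesis
    using N.p_part_in_p_subgroup[OF p n(1)] by blast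
qed

text \<open>
  After twisting \<open>f\<close> one may assume that \<open>f\<close> and \<open>g\<close> have equal \<open>p\<close>-parts. Then \<open>shift f g\<close> preserves the
  kernel of the projection to \<open>N\<^sub>p\<close>, whose order is coprime to that of \<open>S\<close>.
\<close>

lemma cohom_if_cohom_p_part:
  assumes S: "subgroup S J" and cop: "coprime (card S) (N.p'_order p)"
    and f: "cocycle S f" and g: "cocycle S g"
    and fg: "cohom S (\<lambda>k. N.p_part p (f k)) (\<lambda>k. N.p_part p (g k))"
  shows "cohom S f g"
proof -
  obtain n where nP: "n \<in> N.p_subgroup p"
    and n2: "\<And>k. k \<in> S \<Longrightarrow> N.p_part p (N.p_part p (g k)) =
      twist n (\<lambda>k. N.p_part p (N.p_part p (f k))) k"
    using cohom_p_part[OF S cocycle_p_part[OF S f] fg] by blast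
  note n = N.p_subgroup_closed[OF p nP]
  have c: "k \<in> carrier J" "f k \<in> carrier N" "g k \<in> carrier N" if "k \<in> S" for k
    using that subgroup.subset[OF S] f g by (auto simp: cocycle_closed)
  have eq: "N.p_part p (g k) = N.p_part p (twist n f k)" if k: "k \<in> S" for k
    using n2[OF k] n c[OF k]
    by (simp add: p_part_twist N.p_part_p_subgroup[OF p nP])
      (simp add: twist_def N.p_part_idem[OF p])
  have f1: "cocycle S (twist n f)"
    by (rule cocycle_twist[OF S f n])
  have "\<exists>d\<in>N.p'_subgroup p. \<forall>k\<in>S. g k = twist (\<one> \<otimes> d) (twist n f) k"
  proof (rule coprime_coset_cohomologous[OF N.nilpotent N.finite S _ f1 g N.p'_subgroup[OF p]])
    show "finite S" using finite_subset[OF subgroup.subset[OF S] J.finite] .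
    show "coprime (card S) (card (N.p'_subgroup p))"
      using cop by (simp add: N.card_p'_subgroup[OF p])
    fix k d assume k: "k \<in> S" and d: "d \<in> N.p'_subgroup p"
    have dc: "d \<in> carrier N" using N.p'_subgroup_closed[OF p d] .
    have "N.p_part p (\<alpha> k d) = \<one>"
      using act_p_part[OF c(1)[OF k] dc] N.p_part_p'_subgroup[OF p d] c(1)[OF k] by simp
    then have "N.p_part p (shift (twist n f) g k d) = \<one>"
      using c[OF k] n dc eq[OF k] N.p_part_closed[OF p c(3)[OF k]]
      by (simp add: shift_def N.p_part_mult[OF p] N.p_part_inv[OF p])
    then have "shift (twist n f) g k d \<in> N.p'_subgroup p"
      using N.p_part_eq_one_iff[OF p] c[OF k] n dc by simp
    then show "inv \<one> \<otimes> shift (twist n f) g k (\<one> \<otimes> d) \<in> N.p'_subgroup p"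
      using c[OF k] n dc by simp
  qed simp
  then have "cohom S (twist n f) g"
    unfolding cohom_def using N.p'_subgroup_closed[OF p] by auto
  moreover have "cohom S f (twist n f)"
    unfolding cohom_def using n by blast
  ultimately show ?thesis
    using cohom_trans[OF S f] by blast
qed

lemma act_p_p'_commute:
  assumes "j \<in> J.p'_subgroup p" "x \<in> J.p_subgroup p" "n \<in> carrier N"
  shows "\<alpha> j (\<alpha> x n) = \<alpha> x (\<alpha> j n)"
  using J.p_p'_commute[OF p assms(2,1)] assms(3)
    act_mult[OF J.p_subgroup_closed[OF p assms(2)] J.p'_subgroup_closed[OF p assms(1)]]
    act_mult[OF J.p'_subgroup_closed[OF p assms(1)] J.p_subgroup_closed[OF p assms(2)]]
  by simp

lemma act_twist:
  assumes j: "j \<in> J.p'_subgroup p" and x: "x \<in> J.p_subgroup p"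
    and n: "n \<in> carrier N" and f: "f x \<in> carrier N"
  shows "\<alpha> j (twist n f x) = twist (\<alpha> j n) (\<lambda>x. \<alpha> j (f x)) x"
  using J.p_subgroup_closed[OF p x] J.p'_subgroup_closed[OF p j] n f act_p_p'_commute[OF j x n]
  by (simp add: twist_def)

lemma coprime_p_subgroup_J: "coprime (card (J.p_subgroup p)) (N.p'_order p)"
  using prime_imp_coprime_nat[OF p N.not_dvd_p'_order[OF p]]
  by (simp add: J.card_p_subgroup[OF p] J.p_order_def)

text \<open>
  The elements of \<open>N\<^sub>p\<close> that turn \<open>F\<close>, the \<open>p\<close>-part of \<open>f\<close>, into the \<open>p\<close>-part \<open>G\<close> of \<open>g\<close> on \<open>J\<^sub>p\<close> are the fixed points of
  \<open>J\<^sub>p\<close> under \<open>shift F G\<close>. They form a coset of a subgroup \<open>C\<close> of the \<open>p\<close>-group \<open>N\<^sub>p\<close>, and this coset is preserved by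
  \<open>J'\<^sub>p\<close> because \<open>J'\<^sub>p\<close> commutes with \<open>J\<^sub>p\<close>. A point of it fixed by \<open>J'\<^sub>p\<close> is fixed by all of \<open>J\<close>.
\<close>

lemma p_part_cohom_if_restriction_cohom:
  assumes f: "cocycle (carrier J) f" and g: "cocycle (carrier J) g"
    and fg: "cohom (J.p_subgroup p) f g"
  shows "\<exists>n\<in>N.p_subgroup p. \<forall>k\<in>carrier J. N.p_part p (g k) = twist n (\<lambda>k. N.p_part p (f k)) k"
proof -
  define K where "K = J.p_subgroup p"
  define Q where "Q = J.p'_subgroup p"
  define P where "P = N.p_subgroup p"
  define F where "F = (\<lambda>k. N.p_part p (f k))"
  define G where "G = (\<lambda>k. N.p_part p (g k))"
  have K: "subgroup K J" and Q: "subgroup Q J" and P: "subgroup P N"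
    unfolding K_def Q_def P_def
    by (rule J.p_subgroup[OF p], rule J.p'_subgroup[OF p], rule N.p_subgroup[OF p])
  interpret P: subgroup P N by (rule P)
  have Kc: "x \<in> carrier J" if "x \<in> K" for x using that subgroup.subset[OF K] by blast
  have Qc: "j \<in> carrier J" if "j \<in> Q" for j using that subgroup.subset[OF Q] by blast
  have Pc: "n \<in> carrier N" if "n \<in> P" for n using that P.subset by blast
  have FJ: "cocycle (carrier J) F" and GJ: "cocycle (carrier J) G"
    unfolding F_def G_def by (intro cocycle_p_part J.subgroup_self f g)+
  have FP: "F k \<in> P" "G k \<in> P" if "k \<in> carrier J" for k
    using that f g by (auto simp: F_def G_def P_def cocycle_closed intro: N.p_part_in_p_subgroup[OF p])
  have FGc: "F k \<in> carrier N" "G k \<in> carrier N" if "k \<in> carrier J" for k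
    using FP[OF that] Pc by auto
  have shiftP: "shift F G k n \<in> P" if "k \<in> carrier J" "n \<in> P" for k n
    using that FP act_p_subgroup[of k n] unfolding shift_def P_def[symmetric]
    by (intro P.m_closed P.m_inv_closed) auto
  obtain n0 where n0: "n0 \<in> P" "\<And>x. x \<in> K \<Longrightarrow> G x = twist n0 F x"
    using cohom_p_part[OF K cocycle_subset[OF f] fg[folded K_def]] subgroup.subset[OF K]
    unfolding F_def G_def P_def by blast
  have n0c: "n0 \<in> carrier N" using n0 Pc by blast
  have fix0: "shift F G x n0 = n0" if "x \<in> K" for x
    using n0(2)[OF that] shift_fixed_iff[of x F G n0] Kc[OF that] FGc n0c by simp
  define C where "C = {c \<in> P. \<forall>x\<in>K. shift G G x c = c}"
  have CP: "c \<in> P" if "c \<in> C" for c using that by (simp add: C_def)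
  have C: "subgroup C N"
  proof (rule N.subgroupI)
    show "C \<subseteq> carrier N" using Pc by (auto simp: C_def)
    have "\<one> \<in> C" using FGc Kc by (auto simp: C_def shift_def)
    then show "C \<noteq> {}" by blast
  next
    fix c assume c: "c \<in> C"
    then have cP: "c \<in> carrier N" using CP Pc by blast
    have "shift G G x (inv c) = inv (shift G G x c)" if "x \<in> K" for x
      using Kc[OF that] FGc cP by (simp only: shift_def act_inv act_closed N.word_simps)
    then show "inv c \<in> C" using c by (simp add: C_def)
  next
    fix c d assume cd: "c \<in> C" "d \<in> C"
    then have c: "c \<in> carrier N" "d \<in> carrier N" using CP Pc by blast+
    have "shift G G x (c \<otimes> d) = shift G G x c \<otimes> shift G G x d" if "x \<in> K" for x
      using Kc[OF that] FGc c by (simp only: shift_dist)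
    then show "c \<otimes> d \<in> C" using cd by (simp add: C_def)
  qed
  have fixed: "shift F G x (n0 \<otimes> c) = n0 \<otimes> c" if x: "x \<in> K" and c: "c \<in> C" for x c
  proof -
    have "shift F G x (n0 \<otimes> c) = shift F G x n0 \<otimes> shift G G x c"
      using Kc[OF x] FGc n0c CP[OF c] Pc by (intro shift_dist) auto
    then show ?thesis using fix0[OF x] x c by (simp add: C_def)
  qed
  have "\<exists>c\<in>C. \<forall>k\<in>Q. G k = twist (n0 \<otimes> c) F k"
  proof (rule coprime_coset_cohomologous[OF N.nilpotent N.finite Q _ _ _ C _ n0c])
    show "finite Q" using finite_subset[OF subgroup.subset[OF Q] J.finite] .
    show "cocycle Q F" "cocycle Q G"
      using cocycle_subset[OF FJ subgroup.subset[OF Q]] cocycle_subset[OF GJ subgroup.subset[OF Q]] .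
    interpret NP: group "N\<lparr>carrier := P\<rparr>" by (rule N.subgroup_imp_group[OF P])
    have "subgroup C (N\<lparr>carrier := P\<rparr>)"
      using N.subgroup_incl[OF C P] CP by blast
    then have "card C dvd order (N\<lparr>carrier := P\<rparr>)"
      using NP.lagrange by (metis dvd_triv_right)
    then have "card C dvd N.p_order p"
      using N.card_p_subgroup[OF p] by (simp add: order_def P_def)
    moreover have "coprime (J.p'_order p) (N.p_order p)"
      using prime_imp_coprime_nat[OF p J.not_dvd_p'_order[OF p]]
      by (simp add: N.p_order_def coprime_commute)
    ultimately show "coprime (card Q) (card C)"
      using J.card_p'_subgroup[OF p] coprime_divisors[OF dvd_refl] unfolding Q_def by metis
    fix j c assume j: "j \<in> Q" and c: "c \<in> C"
    define m where "m = shift F G j (n0 \<otimes> c)"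
    have mP: "m \<in> P"
      unfolding m_def using j c Qc CP n0(1) by (intro shiftP P.m_closed) auto
    have nc: "n0 \<otimes> c \<in> carrier N" using n0c CP[OF c] Pc by simp
    have m_fixed: "shift F G x m = m" if x: "x \<in> K" for x
    proof -
      have xj: "x \<otimes>\<^bsub>J\<^esub> j = j \<otimes>\<^bsub>J\<^esub> x"
        using J.p_p'_commute[OF p] x j by (simp add: K_def Q_def)
      have "shift F G x m = shift F G (x \<otimes>\<^bsub>J\<^esub> j) (n0 \<otimes> c)"
        unfolding m_def using shift_mult[OF J.subgroup_self FJ GJ Kc[OF x] Qc[OF j] nc] by simp
      also have "\<dots> = shift F G j (shift F G x (n0 \<otimes> c))"
        unfolding xj using shift_mult[OF J.subgroup_self FJ GJ Qc[OF j] Kc[OF x] nc] .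
      finally show ?thesis using fixed[OF x c] by (simp add: m_def)
    qed
    have "shift G G x (inv n0 \<otimes> m) = inv n0 \<otimes> m" if x: "x \<in> K" for x
    proof -
      have "shift G G x (inv n0 \<otimes> m) = inv (shift F G x n0) \<otimes> shift F G x m"
        using Kc[OF x] FGc n0c mP Pc by (simp only: shift_def act_dist act_inv act_closed N.word_simps)
      then show ?thesis using fix0[OF x] m_fixed[OF x] by simp
    qed
    then show "inv n0 \<otimes> shift F G j (n0 \<otimes> c) \<in> C"
      unfolding m_def[symmetric] C_def using n0(1) mP by (auto intro: P.m_closed)
  qed
  then obtain c where c: "c \<in> C" "\<And>k. k \<in> Q \<Longrightarrow> G k = twist (n0 \<otimes> c) F k" by blast
  define n where "n = n0 \<otimes> c"
  have nP: "n \<in> P" using c n0(1) CP by (simp add: n_def)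
  have nQ: "G j = twist n F j" if "j \<in> Q" for j using c(2)[OF that] by (simp add: n_def)
  have nK: "G x = twist n F x" if x: "x \<in> K" for x
    using fixed[OF x c(1)] shift_fixed_iff[of x F G n] Kc[OF x] FGc nP Pc by (simp add: n_def)
  have tw: "cocycle (carrier J) (twist n F)"
    using cocycle_twist[OF J.subgroup_self FJ] nP Pc by blast
  have "G k = twist n F k" if k: "k \<in> carrier J" for k
  proof -
    obtain j where j: "j \<in> J.p'_subgroup p" "J.p_part p k \<in> J.p_subgroup p" "k = J.p_part p k \<otimes>\<^bsub>J\<^esub> j"
      using J.p_p'_decompose[OF p k] .
    define x where "x = J.p_part p k"
    have xj: "x \<in> K" "j \<in> Q" "k = x \<otimes>\<^bsub>J\<^esub> j" using j by (auto simp: K_def Q_def x_def)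
    show ?thesis
      unfolding xj(3) cocycle_mult[OF GJ Kc[OF xj(1)] Qc[OF xj(2)]]
        cocycle_mult[OF tw Kc[OF xj(1)] Qc[OF xj(2)]]
      by (simp add: nQ[OF xj(2)] nK[OF xj(1)])
  qed
  then show ?thesis using nP unfolding F_def G_def P_def by blast
qed

text \<open>
  The class of the \<open>p\<close>-part of \<open>\<psi>\<close> under twisting by \<open>N\<^sub>p\<close> is a transitive \<open>N\<^sub>p\<close>-set on which \<open>J'\<^sub>p\<close>
  acts, so it has a member \<open>\<chi>\<close> with values fixed by \<open>J'\<^sub>p\<close>. Hence the composition of \<open>\<chi>\<close> with the
  projection of \<open>J\<close> to \<open>J\<^sub>p\<close> is a crossed homomorphism on \<open>J\<close>. That \<open>\<chi>\<close> is cohomologous to \<open>\<psi>\<close> itself, and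
  not only to its \<open>p\<close>-part, is \<open>cohom_if_cohom_p_part\<close>.
\<close>

lemma extend_invariant_class:
  assumes \<psi>: "cocycle (J.p_subgroup p) \<psi>"
    and invariant: "\<And>j. j \<in> J.p'_subgroup p \<Longrightarrow> cohom (J.p_subgroup p) \<psi> (\<lambda>x. \<alpha> j (\<psi> x))"
  shows "\<exists>\<phi>. cocycle (carrier J) \<phi> \<and> (\<forall>k\<in>carrier J. N.p_part p (\<phi> k) = \<phi> k) \<and>
    cohom (J.p_subgroup p) \<phi> \<psi>"
proof -
  define K where "K = J.p_subgroup p"
  define Q where "Q = J.p'_subgroup p"
  define P where "P = N.p_subgroup p"
  define \<psi>1 where "\<psi>1 = (\<lambda>k. N.p_part p (\<psi> k))"
  have K: "subgroup K J" and Q: "subgroup Q J" and P: "subgroup P N"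
    unfolding K_def Q_def P_def
    by (rule J.p_subgroup[OF p], rule J.p'_subgroup[OF p], rule N.p_subgroup[OF p])
  interpret P: subgroup P N by (rule P)
  have Kc: "x \<in> carrier J" if "x \<in> K" for x using that subgroup.subset[OF K] by blast
  have Qc: "j \<in> carrier J" if "j \<in> Q" for j using that subgroup.subset[OF Q] by blast
  have Pc: "n \<in> carrier N" if "n \<in> P" for n using that P.subset by blast
  have \<psi>1: "cocycle K \<psi>1"
    unfolding \<psi>1_def by (rule cocycle_p_part[OF K \<psi>[folded K_def]])
  have \<psi>1P: "\<psi>1 x \<in> P" if "x \<in> K" for x
    using that \<psi> by (auto simp: \<psi>1_def P_def K_def cocycle_closed intro: N.p_part_in_p_subgroup[OF p])
  have \<psi>1c: "\<psi>1 x \<in> carrier N" if "x \<in> K" for x using \<psi>1P[OF that] Pc by blast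
  have \<alpha>P: "\<alpha> k n \<in> P" if "k \<in> carrier J" "n \<in> P" for k n
    using that act_p_subgroup by (simp add: P_def)
  have commute: "\<alpha> j (\<alpha> x n) = \<alpha> x (\<alpha> j n)" if "j \<in> Q" "x \<in> K" "n \<in> carrier N" for j x n
    using act_p_p'_commute that by (simp add: K_def Q_def)
  \<comment> \<open>Restricting to \<open>K\<close> makes two members of the class with the same values on \<open>K\<close> equal. The
     group \<open>P\<close> acts on the left, so \<open>m\<close> twists by its inverse.\<close>
  define \<omega> where "\<omega> = (\<lambda>n. \<lambda>x\<in>K. twist n \<psi>1 x)"
  define \<beta> where "\<beta> = (\<lambda>j w. \<lambda>x\<in>K. \<alpha> j (w x) :: 'n)"
  define \<mu> where "\<mu> = (\<lambda>n w. \<lambda>x\<in>K. n \<otimes> w x \<otimes> inv (\<alpha> x n))"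
  have \<mu>\<omega>: "\<mu> m (\<omega> n) = \<omega> (n \<otimes> inv m)" if "m \<in> P" "n \<in> P" for m n
    using that Kc \<psi>1c Pc unfolding \<mu>_def \<omega>_def
    by (intro ext) (simp add: twist_def N.word_simps)
  have \<beta>\<omega>: "\<exists>m\<in>P. \<beta> j (\<omega> n) = \<omega> m" if j: "j \<in> Q" and n: "n \<in> P" for j n
  proof -
    obtain m where m: "m \<in> P" "\<And>x. x \<in> K \<Longrightarrow> N.p_part p (\<alpha> j (\<psi> x)) = twist m \<psi>1 x"
      using cohom_p_part[OF K \<psi>[folded K_def] invariant[OF j[unfolded Q_def], folded K_def]]
      unfolding \<psi>1_def P_def by blast
    have m': "\<alpha> j (\<psi>1 x) = twist m \<psi>1 x" if x: "x \<in> K" for x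
      using m(2)[OF x] act_p_part[OF Qc[OF j], of "\<psi> x"] cocycle_closed[OF \<psi>] x
      by (simp add: \<psi>1_def K_def)
    have "\<alpha> j (twist n \<psi>1 x) = twist (m \<otimes> \<alpha> j n) \<psi>1 x" if x: "x \<in> K" for x
    proof -
      have "\<alpha> j (twist n \<psi>1 x) = twist (\<alpha> j n) (\<lambda>x. \<alpha> j (\<psi>1 x)) x"
        using j x Pc[OF n] \<psi>1c[OF x] by (intro act_twist) (simp_all add: K_def Q_def)
      also have "\<dots> = twist (m \<otimes> \<alpha> j n) \<psi>1 x"
        using Qc[OF j] Kc[OF x] Pc[OF n] \<psi>1c[OF x] Pc[OF m(1)]
        by (simp only: m'[OF x] twist_def act_closed act_dist N.word_simps)
      finally show ?thesis .
    qed
    then have "\<beta> j (\<omega> n) = \<omega> (m \<otimes> \<alpha> j n)"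
      unfolding \<beta>_def \<omega>_def by (intro ext) simp
    moreover have "m \<otimes> \<alpha> j n \<in> P"
      using m(1) \<alpha>P[OF Qc[OF j] n] by simp
    ultimately show ?thesis by blast
  qed
  interpret CA: coprime_transitive_action "J\<lparr>carrier := Q\<rparr>" "N\<lparr>carrier := P\<rparr>" \<alpha> "\<omega> ` P" \<beta> \<mu>
  proof (intro coprime_transitive_action.intro aut_action.intro
      aut_action_axioms.intro coprime_transitive_action_axioms.intro)
    show "group (J\<lparr>carrier := Q\<rparr>)" using Q J.subgroup_imp_group by blast
    show "group (N\<lparr>carrier := P\<rparr>)" using P N.subgroup_imp_group by blast
    show "nilpotent_group (N\<lparr>carrier := P\<rparr>)" using N.nilpotent_subgroup N.nilpotent P by blast
    show "finite (carrier (J\<lparr>carrier := Q\<rparr>))"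
      using finite_subset[OF subgroup.subset[OF Q] J.finite] by simp
    show "finite (carrier (N\<lparr>carrier := P\<rparr>))"
      using finite_subset[OF P.subset N.finite] by simp
    show "coprime (order (J\<lparr>carrier := Q\<rparr>)) (order (N\<lparr>carrier := P\<rparr>))"
      using prime_imp_coprime_nat[OF p J.not_dvd_p'_order[OF p]]
      by (simp add: order_def P_def Q_def N.card_p_subgroup[OF p] J.card_p'_subgroup[OF p]
          N.p_order_def coprime_commute)
    show "\<omega> ` P \<noteq> {}" using P.one_closed by blast
  next
    fix j assume j: "j \<in> carrier (J\<lparr>carrier := Q\<rparr>)"
    show "\<alpha> j \<in> hom (N\<lparr>carrier := P\<rparr>) (N\<lparr>carrier := P\<rparr>)"
      using j Qc \<alpha>P Pc by (auto simp: hom_def)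
    fix w assume "w \<in> \<omega> ` P"
    then show "\<beta> j w \<in> \<omega> ` P" using \<beta>\<omega> j by auto
  next
    fix n assume "n \<in> carrier (N\<lparr>carrier := P\<rparr>)"
    then show "\<alpha> \<one>\<^bsub>J\<lparr>carrier := Q\<rparr>\<^esub> n = n" using Pc by simp
  next
    fix j l n assume "j \<in> carrier (J\<lparr>carrier := Q\<rparr>)" "l \<in> carrier (J\<lparr>carrier := Q\<rparr>)"
      "n \<in> carrier (N\<lparr>carrier := P\<rparr>)"
    then show "\<alpha> (j \<otimes>\<^bsub>J\<lparr>carrier := Q\<rparr>\<^esub> l) n = \<alpha> j (\<alpha> l n)"
      using Pc Qc act_mult by simp
  next
    fix j l w assume jl: "j \<in> carrier (J\<lparr>carrier := Q\<rparr>)" "l \<in> carrier (J\<lparr>carrier := Q\<rparr>)"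
      and "w \<in> \<omega> ` P"
    then obtain n where n: "n \<in> P" "w = \<omega> n" by blast
    show "\<beta> (j \<otimes>\<^bsub>J\<lparr>carrier := Q\<rparr>\<^esub> l) w = \<beta> j (\<beta> l w)"
      using jl n Qc Kc \<psi>1c Pc act_mult unfolding \<beta>_def \<omega>_def by (intro ext) simp
  next
    fix m w assume "m \<in> carrier (N\<lparr>carrier := P\<rparr>)" "w \<in> \<omega> ` P"
    then show "\<mu> m w \<in> \<omega> ` P"
      using \<mu>\<omega> by auto
  next
    fix w assume "w \<in> \<omega> ` P"
    then show "\<mu> \<one>\<^bsub>N\<lparr>carrier := P\<rparr>\<^esub> w = w"
      using \<mu>\<omega>[OF P.one_closed] Pc by auto
  next
    fix m n w assume mn: "m \<in> carrier (N\<lparr>carrier := P\<rparr>)" "n \<in> carrier (N\<lparr>carrier := P\<rparr>)"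
      and "w \<in> \<omega> ` P"
    then obtain r where r: "r \<in> P" "w = \<omega> r" by blast
    then show "\<mu> (m \<otimes>\<^bsub>N\<lparr>carrier := P\<rparr>\<^esub> n) w = \<mu> m (\<mu> n w)"
      using mn Pc by (simp add: \<mu>\<omega> N.inv_mult_group N.m_assoc)
  next
    fix v w assume "v \<in> \<omega> ` P" "w \<in> \<omega> ` P"
    then obtain r s where rs: "r \<in> P" "v = \<omega> r" "s \<in> P" "w = \<omega> s" by blast
    have "r \<otimes> inv (inv s \<otimes> r) = s"
      using rs Pc by (simp only: N.word_simps)
    then have "w = \<mu> (inv s \<otimes> r) v"
      using rs \<mu>\<omega>[of "inv s \<otimes> r" r] by simp
    then show "\<exists>m\<in>carrier (N\<lparr>carrier := P\<rparr>). w = \<mu> m v"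
      using rs by (intro bexI[of _ "inv s \<otimes> r"]) simp_all
  next
    fix j m w assume jm: "j \<in> carrier (J\<lparr>carrier := Q\<rparr>)" "m \<in> carrier (N\<lparr>carrier := P\<rparr>)"
      and "w \<in> \<omega> ` P"
    then obtain n where n: "n \<in> P" "w = \<omega> n" by blast
    show "\<beta> j (\<mu> m w) = \<mu> (\<alpha> j m) (\<beta> j w)"
      using jm n Qc Kc \<psi>1c Pc commute unfolding \<beta>_def \<omega>_def \<mu>_def by (intro ext) simp
  qed
  obtain n where n: "n \<in> P" "\<And>j. j \<in> Q \<Longrightarrow> \<beta> j (\<omega> n) = \<omega> n"
    using CA.fixed_point_exists by auto
  define \<chi> where "\<chi> = twist n \<psi>1"
  have \<chi>: "cocycle K \<chi>"
    unfolding \<chi>_def using cocycle_twist[OF K \<psi>1] n(1) Pc by blast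
  have \<chi>P: "\<chi> x \<in> P" if x: "x \<in> K" for x
    unfolding \<chi>_def twist_def
    using \<psi>1P[OF x] n(1) \<alpha>P[OF Kc[OF x]] by (intro P.m_closed P.m_inv_closed) auto
  have \<chi>_fixed: "\<alpha> j (\<chi> x) = \<chi> x" if "j \<in> Q" "x \<in> K" for j x
    using fun_cong[OF n(2)[OF that(1)], of x] that(2) by (simp add: \<beta>_def \<omega>_def \<chi>_def)
  define \<phi> where "\<phi> = (\<lambda>k. \<chi> (J.p_part p k))"
  have pK: "J.p_part p k \<in> K" if "k \<in> carrier J" for k
    using J.p_part_in_p_subgroup[OF p that] by (simp add: K_def)
  have \<phi>P: "\<phi> k \<in> P" if "k \<in> carrier J" for k
    using \<chi>P[OF pK[OF that]] by (simp add: \<phi>_def)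
  have \<phi>: "cocycle (carrier J) \<phi>"
    unfolding cocycle_def
  proof (intro conjI ballI)
    fix k l assume kl: "k \<in> carrier J" "l \<in> carrier J"
    show "\<phi> k \<in> carrier N" using \<phi>P[OF kl(1)] Pc by blast
    obtain j where j: "j \<in> Q" "k = J.p_part p k \<otimes>\<^bsub>J\<^esub> j"
      using J.p_p'_decompose[OF p kl(1)] unfolding Q_def by metis
    have "\<alpha> k (\<phi> l) = \<alpha> (J.p_part p k) (\<alpha> j (\<phi> l))"
      using act_mult[OF Kc[OF pK[OF kl(1)]] Qc[OF j(1)], of "\<phi> l"] j(2) \<phi>P[OF kl(2)] Pc by simp
    also have "\<dots> = \<alpha> (J.p_part p k) (\<phi> l)"
      using \<chi>_fixed[OF j(1) pK[OF kl(2)]] by (simp add: \<phi>_def)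
    finally show "\<phi> (k \<otimes>\<^bsub>J\<^esub> l) = \<phi> k \<otimes> \<alpha> k (\<phi> l)"
      using cocycle_mult[OF \<chi> pK[OF kl(1)] pK[OF kl(2)]]
      by (simp add: \<phi>_def J.p_part_mult[OF p kl])
  qed
  have \<phi>_part: "N.p_part p (\<phi> k) = \<phi> k" if "k \<in> carrier J" for k
    using N.p_part_p_subgroup[OF p] \<phi>P[OF that] by (simp add: P_def)
  have \<phi>_K: "\<phi> x = \<chi> x" if "x \<in> K" for x
    using J.p_part_p_subgroup[OF p] that by (simp add: \<phi>_def K_def)
  have \<phi>K: "cocycle K \<phi>"
    using cocycle_subset[OF \<phi> subgroup.subset[OF K]] .
  have "N.p_part p (\<phi> k) = twist n \<psi>1 k" if "k \<in> K" for k
    using \<phi>_part[OF Kc[OF that]] \<phi>_K[OF that] by (simp add: \<chi>_def)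
  then have "cohom K \<psi>1 (\<lambda>k. N.p_part p (\<phi> k))"
    unfolding cohom_def using n(1) Pc by blast
  then have "cohom K \<psi> \<phi>"
    using cohom_if_cohom_p_part[OF K _ \<psi>[folded K_def] \<phi>K] coprime_p_subgroup_J
    by (simp add: \<psi>1_def K_def)
  then have "cohom K \<phi> \<psi>"
    using cohom_sym[OF K \<psi>[folded K_def]] by blast
  then show ?thesis
    using \<phi> \<phi>_part unfolding K_def by blast
qed

end

section \<open>Combining the primes\<close>

lemma p_subgroup_trivial:
  assumes "Factorial_Ring.prime p" "\<not> p dvd order J"
  shows "J.p_subgroup p = {\<one>\<^bsub>J\<^esub>}"
proof -
  have "J.p_order p = 1"
    using assms by (simp add: J.p_order_def not_dvd_imp_multiplicity_0)
  then show ?thesis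
    by (auto simp: J.p_subgroup_def power_kernel_def)
qed

text \<open>
  The primary parts of \<open>f\<close> are changed into those of \<open>g\<close> one prime \<open>q\<close> after the other: twisting by an element of
  \<open>N\<^sub>q\<close> leaves the parts at all other primes unchanged. For a prime \<open>q\<close> dividing \<open>|N|\<close> but not
  \<open>|J|\<close> the subgroup \<open>J\<^sub>q\<close> is trivial and imposes no condition.
\<close>

theorem cohom_if_restrictions_cohom:
  assumes f: "cocycle (carrier J) f" and g: "cocycle (carrier J) g"
    and fg: "\<And>p. \<lbrakk>Factorial_Ring.prime p; p dvd order J; p dvd order N\<rbrakk> \<Longrightarrow> cohom (J.p_subgroup p) f g"
  shows "cohom (carrier J) f g"
proof -
  have part: "\<exists>h. cocycle (carrier J) h \<and> cohom (carrier J) f h \<and>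
      (\<forall>q\<in>S. \<forall>k\<in>carrier J. N.p_part q (h k) = N.p_part q (g k))"
    if "finite S" "S \<subseteq> {q. Factorial_Ring.prime q \<and> q dvd order N}" for S
    using that
  proof (induct S rule: finite_induct)
    case empty
    then show ?case using f cohom_refl[OF J.subgroup_self f] by auto
  next
    case (insert q S)
    then obtain h where h: "cocycle (carrier J) h" "cohom (carrier J) f h"
      "\<And>r k. \<lbrakk>r \<in> S; k \<in> carrier J\<rbrakk> \<Longrightarrow> N.p_part r (h k) = N.p_part r (g k)"
      by auto
    have q: "Factorial_Ring.prime q" "q dvd order N" using insert(4) by auto
    have K: "subgroup (J.p_subgroup q) J" by (rule J.p_subgroup[OF q(1)])
    note KJ = subgroup.subset[OF K]
    have "cohom (J.p_subgroup q) h g"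
    proof (cases "q dvd order J")
      case True
      have "cohom (J.p_subgroup q) h f"
        using cohom_sym[OF J.subgroup_self f h(2)] cohom_subset KJ by blast
      then show ?thesis
        using cohom_trans[OF K cocycle_subset[OF h(1) KJ]] fg[OF q(1) True q(2)] by blast
    next
      case False
      then show ?thesis
        using cocycle_one[OF J.subgroup_self g] cocycle_one[OF J.subgroup_self h(1)]
          p_subgroup_trivial[OF q(1)] by (intro cohom_refl[OF K cocycle_subset[OF h(1) KJ]]) auto
    qed
    then obtain n where n: "n \<in> N.p_subgroup q"
      "\<And>k. k \<in> carrier J \<Longrightarrow> N.p_part q (g k) = twist n (\<lambda>k. N.p_part q (h k)) k"
      using p_part_cohom_if_restriction_cohom[OF q(1) h(1) g] by blast
    have nc: "n \<in> carrier N" using N.p_subgroup_closed[OF q(1) n(1)] .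
    have "N.p_part r (twist n h k) = N.p_part r (g k)" if r: "r \<in> insert q S" and k: "k \<in> carrier J" for r k
    proof -
      have hk: "h k \<in> carrier N" using cocycle_closed[OF h(1) k] .
      have rp: "Factorial_Ring.prime r" using r insert(4) by auto
      show ?thesis
      proof (cases "r = q")
        case True
        then show ?thesis
          using n(2)[OF k] p_part_twist[OF q(1) nc k, of h] hk N.p_part_p_subgroup[OF q(1) n(1)] by simp
      next
        case False
        have "N.p_part r n = \<one>"
          using N.p_part_p_part_distinct[OF rp q(1) False nc] N.p_part_p_subgroup[OF q(1) n(1)] by simp
        then show ?thesis
          using h(3)[of r k] r False k p_part_twist[OF rp nc k, of h] hk
            twist_one[OF k, of "\<lambda>k. N.p_part r (h k)"] N.p_part_closed[OF rp hk] by simp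
      qed
    qed
    moreover have "cohom (carrier J) f (twist n h)"
      using cohom_trans[OF J.subgroup_self f h(2)] nc unfolding cohom_def by blast
    moreover have "cocycle (carrier J) (twist n h)"
      using cocycle_twist[OF J.subgroup_self h(1) nc] .
    ultimately show ?case by blast
  qed
  have "finite {q. Factorial_Ring.prime q \<and> q dvd order N}"
    using finite_divisors_nat[OF N.order_pos] by (rule rev_finite_subset) auto
  then obtain h where h: "cocycle (carrier J) h" "cohom (carrier J) f h"
    "\<And>q k. \<lbrakk>Factorial_Ring.prime q; q dvd order N; k \<in> carrier J\<rbrakk> \<Longrightarrow> N.p_part q (h k) = N.p_part q (g k)"
    using part[OF _ subset_refl] by auto
  have "g k = h k" if k: "k \<in> carrier J" for k
    using N.p_part_separate[of "g k" "h k"] h(3) k cocycle_closed[OF g k] cocycle_closed[OF h(1) k] by simp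
  then show ?thesis
    using cohom_trans[OF J.subgroup_self f h(2)] cohom_refl[OF J.subgroup_self h(1)] by blast
qed

text \<open>
  The pointwise product of crossed homomorphisms whose values lie in commuting \<open>J\<close>-invariant
  subgroups is again a crossed homomorphism. That the parts at the remaining primes are trivial
  is what lets the next factor commute with the product so far.
\<close>

lemma glue_p_parts:
  assumes "finite S" "\<And>p. p \<in> S \<Longrightarrow> Factorial_Ring.prime p"
    and "\<And>p. p \<in> S \<Longrightarrow> cocycle (carrier J) (\<phi> p)"
    and "\<And>p k. \<lbrakk>p \<in> S; k \<in> carrier J\<rbrakk> \<Longrightarrow> N.p_part p (\<phi> p k) = \<phi> p k"
  shows "\<exists>f. cocycle (carrier J) f \<and> (\<forall>p\<in>S. \<forall>k\<in>carrier J. N.p_part p (f k) = \<phi> p k) \<and>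
    (\<forall>q. Factorial_Ring.prime q \<longrightarrow> q \<notin> S \<longrightarrow> (\<forall>k\<in>carrier J. N.p_part q (f k) = \<one>))"
  using assms
proof (induct S rule: finite_induct)
  case empty
  show ?case
    by (rule exI[of _ "\<lambda>_. \<one>"]) (auto simp: cocycle_def)
next
  case (insert p S)
  then obtain f where f: "cocycle (carrier J) f"
    "\<And>q k. \<lbrakk>q \<in> S; k \<in> carrier J\<rbrakk> \<Longrightarrow> N.p_part q (f k) = \<phi> q k"
    "\<And>q k. \<lbrakk>Factorial_Ring.prime q; q \<notin> S; k \<in> carrier J\<rbrakk> \<Longrightarrow> N.p_part q (f k) = \<one>"
    by (metis insertI2)
  have p: "Factorial_Ring.prime p" and \<phi>: "cocycle (carrier J) (\<phi> p)"
    and \<phi>p: "\<And>k. k \<in> carrier J \<Longrightarrow> N.p_part p (\<phi> p k) = \<phi> p k"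
    using insert by auto
  have c: "f k \<in> carrier N" "\<phi> p k \<in> carrier N" if "k \<in> carrier J" for k
    using cocycle_closed[OF f(1) that] cocycle_closed[OF \<phi> that] .
  have com: "\<phi> p k \<otimes> \<alpha> k (f l) = \<alpha> k (f l) \<otimes> \<phi> p k" if kl: "k \<in> carrier J" "l \<in> carrier J" for k l
  proof (rule N.p_p'_commute[OF p])
    show "\<phi> p k \<in> N.p_subgroup p"
      using N.p_part_in_p_subgroup[OF p c(2)[OF kl(1)]] \<phi>p[OF kl(1)] by simp
    have "N.p_part p (\<alpha> k (f l)) = \<one>"
      using act_p_part[OF p kl(1) c(1)[OF kl(2)]] f(3)[OF p insert(2) kl(2)] kl(1) by simp
    then show "\<alpha> k (f l) \<in> N.p'_subgroup p"
      using N.p_part_eq_one_iff[OF p] kl c by simp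
  qed
  let ?g = "\<lambda>k. f k \<otimes> \<phi> p k"
  have "cocycle (carrier J) ?g"
    unfolding cocycle_def
  proof (intro conjI ballI)
    fix k l assume kl: "k \<in> carrier J" "l \<in> carrier J"
    show "?g k \<in> carrier N" using c[OF kl(1)] by simp
    have "?g (k \<otimes>\<^bsub>J\<^esub> l) = f k \<otimes> (\<alpha> k (f l) \<otimes> \<phi> p k) \<otimes> \<alpha> k (\<phi> p l)"
      using kl c[OF kl(1)] c[OF kl(2)]
      by (simp add: cocycle_mult[OF f(1) kl] cocycle_mult[OF \<phi> kl] N.m_assoc)
    also have "\<dots> = ?g k \<otimes> \<alpha> k (?g l)"
      unfolding com[OF kl, symmetric]
      using kl c[OF kl(1)] c[OF kl(2)] by (simp add: N.m_assoc)
    finally show "?g (k \<otimes>\<^bsub>J\<^esub> l) = ?g k \<otimes> \<alpha> k (?g l)" .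
  qed
  moreover have "N.p_part q (?g k) = \<phi> q k" if q: "q \<in> insert p S" and k: "k \<in> carrier J" for q k
  proof -
    have qp: "Factorial_Ring.prime q" using q insert(4) by blast
    show ?thesis
    proof (cases "q = p")
      case True
      then show ?thesis
        using k c[OF k] f(3)[OF p insert(2) k] \<phi>p[OF k] by (simp add: N.p_part_mult[OF p])
    next
      case False
      have "N.p_part q (\<phi> p k) = \<one>"
        using N.p_part_p_part_distinct[OF qp p False c(2)[OF k]] \<phi>p[OF k] by simp
      then show ?thesis
        using q False k c[OF k] f(2)[of q k] N.p_part_closed[OF qp c(1)[OF k]]
        by (simp add: N.p_part_mult[OF qp])
    qed
  qed
  moreover have "N.p_part q (?g k) = \<one>"
    if q: "Factorial_Ring.prime q" "q \<notin> insert p S" and k: "k \<in> carrier J" for q k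
  proof -
    have "N.p_part q (\<phi> p k) = \<one>"
      using N.p_part_p_part_distinct[OF q(1) p _ c(2)[OF k]] \<phi>p[OF k] q(2) by auto
    then show ?thesis
      using q k c[OF k] f(3)[of q k] by (simp add: N.p_part_mult[OF q(1)])
  qed
  ultimately show ?case by blast
qed

theorem exists_cocycle_with_restrictions:
  assumes D: "finite D" "\<And>p. p \<in> D \<Longrightarrow> Factorial_Ring.prime p"
    and \<psi>: "\<And>p. p \<in> D \<Longrightarrow> cocycle (J.p_subgroup p) (\<psi> p)"
    and invariant: "\<And>p j. \<lbrakk>p \<in> D; j \<in> J.p'_subgroup p\<rbrakk> \<Longrightarrow>
      cohom (J.p_subgroup p) (\<psi> p) (\<lambda>x. \<alpha> j (\<psi> p x))"
  shows "\<exists>f. cocycle (carrier J) f \<and> (\<forall>p\<in>D. cohom (J.p_subgroup p) f (\<psi> p))"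
proof -
  have "\<forall>p\<in>D. \<exists>\<phi>. cocycle (carrier J) \<phi> \<and> (\<forall>k\<in>carrier J. N.p_part p (\<phi> k) = \<phi> k) \<and>
      cohom (J.p_subgroup p) \<phi> (\<psi> p)"
    using extend_invariant_class[OF D(2) \<psi> invariant] by blast
  then obtain \<phi> where \<phi>: "\<And>p. p \<in> D \<Longrightarrow> cocycle (carrier J) (\<phi> p)"
    "\<And>p k. \<lbrakk>p \<in> D; k \<in> carrier J\<rbrakk> \<Longrightarrow> N.p_part p (\<phi> p k) = \<phi> p k"
    "\<And>p. p \<in> D \<Longrightarrow> cohom (J.p_subgroup p) (\<phi> p) (\<psi> p)"
    by metis
  obtain f where f: "cocycle (carrier J) f"
    "\<And>p k. \<lbrakk>p \<in> D; k \<in> carrier J\<rbrakk> \<Longrightarrow> N.p_part p (f k) = \<phi> p k"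
    using glue_p_parts[OF D \<phi>(1,2)] by blast
  have "cohom (J.p_subgroup p) f (\<psi> p)" if p: "p \<in> D" for p
  proof -
    note pr = D(2)[OF p]
    have K: "subgroup (J.p_subgroup p) J" by (rule J.p_subgroup[OF pr])
    note KJ = subgroup.subset[OF K]
    have fK: "cocycle (J.p_subgroup p) f" and \<phi>K: "cocycle (J.p_subgroup p) (\<phi> p)"
      using cocycle_subset[OF f(1) KJ] cocycle_subset[OF \<phi>(1)[OF p] KJ] .
    have "cohom (J.p_subgroup p) f (\<phi> p)"
    proof (rule cohom_if_cohom_p_part[OF pr K coprime_p_subgroup_J[OF pr] fK \<phi>K])
      show "cohom (J.p_subgroup p) (\<lambda>k. N.p_part p (f k)) (\<lambda>k. N.p_part p (\<phi> p k))"
        using f(2)[OF p] \<phi>(2)[OF p] KJ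
        by (intro cohom_refl[OF K cocycle_p_part[OF pr K fK]]) auto
    qed
    then show ?thesis
      using cohom_trans[OF K fK] \<phi>(3)[OF p] by blast
  qed
  then show ?thesis using f(1) by blast
qed

end

section \<open>The restriction map on cohomology sets\<close>

lemma (in aut_action) cocycle_cong:
  assumes "subgroup S J" "\<And>k. k \<in> S \<Longrightarrow> f k = g k"
  shows "cocycle S f \<longleftrightarrow> cocycle S g"
  using assms subgroup.m_closed[OF assms(1)] by (simp add: cocycle_def)

lemma (in aut_action) cohom_cong:
  assumes "\<And>k. k \<in> S \<Longrightarrow> f k = f' k" "\<And>k. k \<in> S \<Longrightarrow> g k = g' k"
  shows "cohom S f g \<longleftrightarrow> cohom S f' g'"
  using assms by (simp add: cohom_def twist_def)

text \<open>
  Expanding \<open>f(j x) = f(x j)\<close> for commuting \<open>j\<close> and \<open>x\<close> shows that \<open>f(j)\<close> is the element turning \<open>f\<close>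
  into its conjugate under \<open>j\<close>.
\<close>

lemma (in nilpotent_action) restriction_invariant:
  assumes p: "Factorial_Ring.prime p" and f: "cocycle (carrier J) f" and j: "j \<in> J.p'_subgroup p"
  shows "cohom (J.p_subgroup p) f (\<lambda>x. \<alpha> j (f x))"
  unfolding cohom_def
proof (intro bexI ballI)
  have jc: "j \<in> carrier J" using J.p'_subgroup_closed[OF p j] .
  show "f j \<in> carrier N" using cocycle_closed[OF f jc] .
  fix x assume x: "x \<in> J.p_subgroup p"
  have xc: "x \<in> carrier J" using J.p_subgroup_closed[OF p x] .
  note c = cocycle_closed[OF f jc] cocycle_closed[OF f xc]
  have "f j \<otimes> \<alpha> j (f x) = f x \<otimes> \<alpha> x (f j)"
    using cocycle_mult[OF f jc xc] cocycle_mult[OF f xc jc] J.p_p'_commute[OF p x j] by simp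
  then have "inv (f j) \<otimes> (f j \<otimes> \<alpha> j (f x)) = twist (f j) f x"
    using c xc by (simp add: twist_def N.m_assoc)
  then show "\<alpha> j (f x) = twist (f j) f x"
    using c jc by (simp add: N.cancel_left)
qed

locale nilpotent_right_action = nilpotent_action J N "\<lambda>k. act (inv\<^bsub>J\<^esub> k)"
  for J :: "('j, 'x) monoid_scheme" and N :: "('n, 'y) monoid_scheme" (structure)
    and act :: "'j \<Rightarrow> 'n \<Rightarrow> 'n"
begin

lemma crossed_homs_iff:
  assumes K: "subgroup K J"
  shows "\<phi> \<in> crossed_homs (J\<lparr>carrier := K\<rparr>) N act \<longleftrightarrow> \<phi> \<in> extensional K \<and> cocycle K \<phi>"
  using J.m_inv_consistent[OF K] by (auto simp: crossed_homs_def cocycle_def PiE_iff)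

lemma cohomologous_iff:
  assumes K: "subgroup K J"
  shows "(\<phi>, \<psi>) \<in> cohomologous (J\<lparr>carrier := K\<rparr>) N act \<longleftrightarrow>
    \<phi> \<in> crossed_homs (J\<lparr>carrier := K\<rparr>) N act \<and> \<psi> \<in> crossed_homs (J\<lparr>carrier := K\<rparr>) N act \<and> cohom K \<phi> \<psi>"
  using J.m_inv_consistent[OF K] by (auto simp: cohomologous_def cohom_def twist_def)

lemma equiv_cohomologous:
  assumes K: "subgroup K J"
  shows "equiv (crossed_homs (J\<lparr>carrier := K\<rparr>) N act) (cohomologous (J\<lparr>carrier := K\<rparr>) N act)"
proof (rule equivI)
  show "cohomologous (J\<lparr>carrier := K\<rparr>) N act
      \<subseteq> crossed_homs (J\<lparr>carrier := K\<rparr>) N act \<times> crossed_homs (J\<lparr>carrier := K\<rparr>) N act"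
    by (auto simp: cohomologous_def)
  show "refl_on (crossed_homs (J\<lparr>carrier := K\<rparr>) N act) (cohomologous (J\<lparr>carrier := K\<rparr>) N act)"
    using cohom_refl[OF K]
    by (auto simp: refl_on_def cohomologous_iff[OF K] crossed_homs_iff[OF K])
  show "sym (cohomologous (J\<lparr>carrier := K\<rparr>) N act)"
    using cohom_sym[OF K] by (auto simp: sym_def cohomologous_iff[OF K] crossed_homs_iff[OF K])
  show "trans (cohomologous (J\<lparr>carrier := K\<rparr>) N act)"
    using cohom_trans[OF K]
    by (intro transI) (auto simp: cohomologous_iff[OF K] crossed_homs_iff[OF K])
qed

lemma cohom_class_eq_iff:
  assumes K: "subgroup K J"
    and "\<phi> \<in> crossed_homs (J\<lparr>carrier := K\<rparr>) N act" "\<psi> \<in> crossed_homs (J\<lparr>carrier := K\<rparr>) N act"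
  shows "cohom_class (J\<lparr>carrier := K\<rparr>) N act \<phi> = cohom_class (J\<lparr>carrier := K\<rparr>) N act \<psi> \<longleftrightarrow> cohom K \<phi> \<psi>"
  unfolding cohom_class_def
  using eq_equiv_class_iff[OF equiv_cohomologous[OF K] assms(2,3)] cohomologous_iff[OF K] assms(2,3)
  by simp

lemma mem_cohom_class_iff:
  assumes K: "subgroup K J"
    and "\<phi> \<in> crossed_homs (J\<lparr>carrier := K\<rparr>) N act"
  shows "\<psi> \<in> cohom_class (J\<lparr>carrier := K\<rparr>) N act \<phi> \<longleftrightarrow>
    \<psi> \<in> crossed_homs (J\<lparr>carrier := K\<rparr>) N act \<and> cohom K \<phi> \<psi>"
  using assms cohomologous_iff[OF K] by (simp add: cohom_class_def)

lemma H1_carrier: "fst (H1 K N act) = cohom_class K N act ` crossed_homs K N act"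
  by (auto simp: H1_def quotient_def cohom_class_def)

text \<open>
  Since \<open>J'\<^sub>p\<close> centralizes \<open>J\<^sub>p\<close>, the action on functions on \<open>J\<^sub>p\<close> is the action on their values. It
  respects cohomology, so a class is mapped to itself as soon as one representative stays in it. The
  operator \<open>A j\<close> in the proof is the action of \<open>j\<^sup>-\<^sup>1\<close>, matching the left action \<open>\<alpha> j\<close>; the inverse does not
  change the condition, which is imposed on all of the group \<open>J'\<^sub>p\<close>.
\<close>

lemma H1_fixed_iff:
  assumes p: "Factorial_Ring.prime p"
    and \<phi>: "\<phi> \<in> crossed_homs (J\<lparr>carrier := J.p_subgroup p\<rparr>) N act"
  shows "cohom_class (J\<lparr>carrier := J.p_subgroup p\<rparr>) N act \<phi>
      \<in> fst (H1_fixed J N act (J.p_subgroup p) (J.p'_subgroup p)) \<longleftrightarrow>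
    (\<forall>j\<in>J.p'_subgroup p. cohom (J.p_subgroup p) \<phi> (\<lambda>x. act (inv\<^bsub>J\<^esub> j) (\<phi> x)))"
proof -
  define K where "K = J.p_subgroup p"
  define Q where "Q = J.p'_subgroup p"
  define c where "c = cohom_class (J\<lparr>carrier := K\<rparr>) N act \<phi>"
  have K: "subgroup K J" and Q: "subgroup Q J"
    unfolding K_def Q_def by (rule J.p_subgroup[OF p], rule J.p'_subgroup[OF p])
  have Kc: "x \<in> carrier J" if "x \<in> K" for x using that subgroup.subset[OF K] by blast
  have Qc: "j \<in> carrier J" if "j \<in> Q" for j using that subgroup.subset[OF Q] by blast
  have \<phi>K: "\<phi> \<in> crossed_homs (J\<lparr>carrier := K\<rparr>) N act" using \<phi> by (simp add: K_def)
  then have \<phi>c: "cocycle K \<phi>" using crossed_homs_iff[OF K] by blast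
  note mem = mem_cohom_class_iff[OF K \<phi>K, folded c_def]
  define A where "A = (\<lambda>j. crossed_hom_act J act K (inv\<^bsub>J\<^esub> j))"
  have A: "A j \<psi> = (\<lambda>x\<in>K. act (inv\<^bsub>J\<^esub> j) (\<psi> x))" if j: "j \<in> Q" for j \<psi>
  proof -
    have "inv\<^bsub>J\<^esub> j \<otimes>\<^bsub>J\<^esub> x \<otimes>\<^bsub>J\<^esub> inv\<^bsub>J\<^esub> (inv\<^bsub>J\<^esub> j) = x" if x: "x \<in> K" for x
    proof -
      have "x \<otimes>\<^bsub>J\<^esub> j = j \<otimes>\<^bsub>J\<^esub> x"
        using J.p_p'_commute[OF p] x j by (simp add: K_def Q_def)
      then show ?thesis
        using Kc[OF x] Qc[OF j] by (simp add: J.m_assoc J.cancel_left)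
    qed
    then show ?thesis
      by (auto simp: A_def crossed_hom_act_def)
  qed
  have A_crossed: "A j \<psi> \<in> crossed_homs (J\<lparr>carrier := K\<rparr>) N act"
    if j: "j \<in> Q" and \<psi>: "\<psi> \<in> crossed_homs (J\<lparr>carrier := K\<rparr>) N act" for j \<psi>
  proof -
    have \<psi>c: "cocycle K \<psi>" using \<psi> crossed_homs_iff[OF K] by blast
    have "cocycle K (\<lambda>x. act (inv\<^bsub>J\<^esub> j) (\<psi> x))"
      unfolding cocycle_def
    proof (intro conjI ballI)
      fix x y assume xy: "x \<in> K" "y \<in> K"
      note c = cocycle_closed[OF \<psi>c xy(1)] cocycle_closed[OF \<psi>c xy(2)]
      show "act (inv\<^bsub>J\<^esub> j) (\<psi> x) \<in> carrier N" using act_closed[OF Qc[OF j] c(1)] .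
      show "act (inv\<^bsub>J\<^esub> j) (\<psi> (x \<otimes>\<^bsub>J\<^esub> y)) =
          act (inv\<^bsub>J\<^esub> j) (\<psi> x) \<otimes> act (inv\<^bsub>J\<^esub> x) (act (inv\<^bsub>J\<^esub> j) (\<psi> y))"
        using act_p_p'_commute[OF p j[unfolded Q_def] xy(1)[unfolded K_def] c(2)]
          act_dist[OF Qc[OF j] c(1) act_closed[OF Kc[OF xy(1)] c(2)]]
        by (simp add: cocycle_mult[OF \<psi>c xy])
    qed
    then show ?thesis
      unfolding A[OF j] crossed_homs_iff[OF K]
      using cocycle_cong[OF K, of "\<lambda>x\<in>K. act (inv\<^bsub>J\<^esub> j) (\<psi> x)" "\<lambda>x. act (inv\<^bsub>J\<^esub> j) (\<psi> x)"]
      by simp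
  qed
  have A_eq: "cohom K \<phi> (A j \<psi>) \<longleftrightarrow> cohom K \<phi> (\<lambda>x. act (inv\<^bsub>J\<^esub> j) (\<psi> x))" if "j \<in> Q" for j \<psi>
    using A[OF that] by (intro cohom_cong) auto
  have A_cohom: "cohom K (A j \<phi>) (A j \<psi>)" if j: "j \<in> Q" and \<psi>: "cohom K \<phi> \<psi>" for j \<psi>
  proof -
    obtain n where n: "n \<in> carrier N" "\<And>x. x \<in> K \<Longrightarrow> \<psi> x = twist n \<phi> x"
      using \<psi> unfolding cohom_def by blast
    have "A j \<psi> x = twist (act (inv\<^bsub>J\<^esub> j) n) (A j \<phi>) x" if x: "x \<in> K" for x
      using act_twist[where f = \<phi>, OF p j[unfolded Q_def] x[unfolded K_def] n(1) cocycle_closed[OF \<phi>c x]]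
        n(2)[OF x] x by (simp add: A[OF j] twist_def)
    then show ?thesis
      unfolding cohom_def using act_closed[OF Qc[OF j] n(1)] by blast
  qed
  have c_H1: "c \<in> fst (H1 (J\<lparr>carrier := K\<rparr>) N act)"
    unfolding H1_carrier c_def using \<phi>K by blast
  have inv_Q: "inv\<^bsub>J\<^esub> j \<in> Q" if "j \<in> Q" for j
    using subgroup.m_inv_closed[OF Q that] .
  have "(\<forall>j\<in>Q. crossed_hom_act J act K j ` c = c) \<longleftrightarrow> (\<forall>j\<in>Q. A j ` c = c)"
  proof (intro iffI ballI)
    fix j assume "\<forall>j\<in>Q. crossed_hom_act J act K j ` c = c" "j \<in> Q"
    then show "A j ` c = c" using inv_Q by (simp add: A_def)
  next
    fix j assume a: "\<forall>j\<in>Q. A j ` c = c" "j \<in> Q"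
    have "A (inv\<^bsub>J\<^esub> j) = crossed_hom_act J act K j"
      using Qc[OF a(2)] by (simp add: A_def)
    then show "crossed_hom_act J act K j ` c = c" using a inv_Q by metis
  qed
  also have "\<dots> \<longleftrightarrow> (\<forall>j\<in>Q. cohom K \<phi> (\<lambda>x. act (inv\<^bsub>J\<^esub> j) (\<phi> x)))"
  proof (intro iffI ballI)
    fix j assume a: "\<forall>j\<in>Q. A j ` c = c" and j: "j \<in> Q"
    have "\<phi> \<in> c" using mem \<phi>K cohom_refl[OF K \<phi>c] by blast
    then have "A j \<phi> \<in> c" using a j by blast
    then show "cohom K \<phi> (\<lambda>x. act (inv\<^bsub>J\<^esub> j) (\<phi> x))"
      using mem A_eq[OF j] by blast
  next
    fix j assume a: "\<forall>j\<in>Q. cohom K \<phi> (\<lambda>x. act (inv\<^bsub>J\<^esub> j) (\<phi> x))" and j: "j \<in> Q"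
    have A_c: "A i \<psi> \<in> c" if i: "i \<in> Q" and \<psi>: "\<psi> \<in> c" for i \<psi>
    proof -
      have "cohom K \<phi> (A i \<psi>)"
        using a i \<psi> mem A_eq[OF i] A_cohom[OF i] cohom_trans[OF K \<phi>c] by blast
      then show ?thesis
        using mem A_crossed[OF i] \<psi> by blast
    qed
    have "\<psi> = A j (A (inv\<^bsub>J\<^esub> j) \<psi>)" if \<psi>: "\<psi> \<in> c" for \<psi>
    proof
      fix x
      have \<psi>K: "\<psi> \<in> extensional K" "cocycle K \<psi>"
        using \<psi> mem crossed_homs_iff[OF K] by auto
      show "\<psi> x = A j (A (inv\<^bsub>J\<^esub> j) \<psi>) x"
      proof (cases "x \<in> K")
        case True
        note cx = cocycle_closed[OF \<psi>K(2) True]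
        have "act (inv\<^bsub>J\<^esub> j) (act (inv\<^bsub>J\<^esub> (inv\<^bsub>J\<^esub> j)) (\<psi> x)) = act (inv\<^bsub>J\<^esub> (j \<otimes>\<^bsub>J\<^esub> inv\<^bsub>J\<^esub> j)) (\<psi> x)"
          using act_mult[OF Qc[OF j] Qc[OF inv_Q[OF j]] cx] by simp
        also have "\<dots> = \<psi> x"
          using act_one[OF cx] Qc[OF j] by simp
        finally show ?thesis
          using True by (simp add: A[OF j] A[OF inv_Q[OF j]])
      next
        case False
        then show ?thesis
          using \<psi>K(1) by (simp add: A[OF j] extensional_def)
      qed
    qed
    then have "c \<subseteq> A j ` c"
      using A_c[OF inv_Q[OF j]] by blast
    then show "A j ` c = c"
      using A_c[OF j] by blast
  qed
  finally show ?thesis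
    using c_H1 unfolding H1_fixed_def c_def K_def Q_def by simp
qed

lemma crossed_homs_carrier_iff:
  "\<phi> \<in> crossed_homs J N act \<longleftrightarrow> \<phi> \<in> extensional (carrier J) \<and> cocycle (carrier J) \<phi>"
  using crossed_homs_iff[OF J.subgroup_self] by simp

lemmas mem_cohom_class_carrier_iff = mem_cohom_class_iff[OF J.subgroup_self, simplified]
lemmas cohom_class_carrier_eq_iff = cohom_class_eq_iff[OF J.subgroup_self, simplified]

lemma restrict_crossed_hom:
  assumes K: "subgroup K J" and \<phi>: "\<phi> \<in> crossed_homs J N act"
  shows "restrict \<phi> K \<in> crossed_homs (J\<lparr>carrier := K\<rparr>) N act"
proof -
  have "cocycle K \<phi>"
    using \<phi> crossed_homs_carrier_iff cocycle_subset subgroup.subset[OF K] by blast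
  then show ?thesis
    using cocycle_cong[OF K, of "restrict \<phi> K" \<phi>] crossed_homs_iff[OF K] by simp
qed

theorem restriction_pointed_iso:
  assumes D: "D = {p :: nat. Factorial_Ring.prime p \<and> p dvd order J \<and> p dvd order N}"
  shows "\<exists>F. (\<forall>\<phi>\<in>crossed_homs J N act.
              F (cohom_class J N act \<phi>) =
                (\<lambda>p\<in>D. cohom_class (J\<lparr>carrier := J.p_subgroup p\<rparr>) N act
                          (restrict \<phi> (J.p_subgroup p)))) \<and>
            pointed_iso F (H1 J N act)
              (pointed_prod D (\<lambda>p. H1_fixed J N act (J.p_subgroup p) (J.p'_subgroup p)))"
proof -
  have Dp: "Factorial_Ring.prime p" if "p \<in> D" for p using that D by blast
  have finD: "finite D"
    using finite_divisors_nat[OF N.order_pos] by (rule rev_finite_subset) (auto simp: D)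
  have K: "subgroup (J.p_subgroup p) J" if "p \<in> D" for p
    using J.p_subgroup[OF Dp[OF that]] .
  define res where "res = (\<lambda>\<phi>. \<lambda>p\<in>D. cohom_class (J\<lparr>carrier := J.p_subgroup p\<rparr>) N act
      (restrict \<phi> (J.p_subgroup p)))"
  \<comment> \<open>By \<open>F_class\<close> the choice of a representative does not matter.\<close>
  define F where "F = (\<lambda>c. res (SOME \<phi>. \<phi> \<in> c))"
  have restrict_cohom: "cohom (J.p_subgroup p) (restrict \<phi> (J.p_subgroup p)) (restrict \<psi> (J.p_subgroup p))
      \<longleftrightarrow> cohom (J.p_subgroup p) \<phi> \<psi>" for p \<phi> \<psi>
    by (intro cohom_cong) auto
  have res_eq_iff: "res \<phi> = res \<psi> \<longleftrightarrow> (\<forall>p\<in>D. cohom (J.p_subgroup p) \<phi> \<psi>)"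
    if "\<phi> \<in> crossed_homs J N act" "\<psi> \<in> crossed_homs J N act" for \<phi> \<psi>
  proof -
    have "res \<phi> \<in> extensional D" "res \<psi> \<in> extensional D"
      by (simp_all add: res_def)
    then have "res \<phi> = res \<psi> \<longleftrightarrow> (\<forall>p\<in>D. res \<phi> p = res \<psi> p)"
      using extensionalityI[of "res \<phi>" D "res \<psi>"] by auto
    also have "\<dots> \<longleftrightarrow> (\<forall>p\<in>D. cohom (J.p_subgroup p) \<phi> \<psi>)"
      using cohom_class_eq_iff[OF K restrict_crossed_hom[OF K that(1)] restrict_crossed_hom[OF K that(2)]]
      by (simp add: res_def restrict_cohom)
    finally show ?thesis .
  qed
  have F_class: "F (cohom_class J N act \<phi>) = res \<phi>" if \<phi>: "\<phi> \<in> crossed_homs J N act" for \<phi>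
  proof -
    define \<psi> where "\<psi> = (SOME \<psi>. \<psi> \<in> cohom_class J N act \<phi>)"
    have "\<phi> \<in> cohom_class J N act \<phi>"
      using mem_cohom_class_carrier_iff[OF \<phi>] \<phi> cohom_refl[OF J.subgroup_self]
        crossed_homs_carrier_iff by blast
    then have "\<psi> \<in> cohom_class J N act \<phi>"
      unfolding \<psi>_def by (rule someI[of "\<lambda>\<psi>. \<psi> \<in> cohom_class J N act \<phi>"])
    then have \<psi>: "\<psi> \<in> crossed_homs J N act" "cohom (carrier J) \<phi> \<psi>"
      using mem_cohom_class_carrier_iff[OF \<phi>] by auto
    then have "res \<phi> = res \<psi>"
      using res_eq_iff[OF \<phi> \<psi>(1)] cohom_subset[OF \<psi>(2) subgroup.subset[OF K]] by blast
    then show ?thesis by (simp add: F_def \<psi>_def)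
  qed
  define A where "A = (\<lambda>p. H1_fixed J N act (J.p_subgroup p) (J.p'_subgroup p))"
  have res_mem: "res \<phi> \<in> (\<Pi>\<^sub>E p\<in>D. fst (A p))" if \<phi>: "\<phi> \<in> crossed_homs J N act" for \<phi>
  proof (rule PiE_I)
    fix p assume p: "p \<in> D"
    have "cohom (J.p_subgroup p) (restrict \<phi> (J.p_subgroup p))
        (\<lambda>x. act (inv\<^bsub>J\<^esub> j) (restrict \<phi> (J.p_subgroup p) x))" if j: "j \<in> J.p'_subgroup p" for j
      using restriction_invariant[OF Dp[OF p] _ j, of \<phi>] \<phi> crossed_homs_carrier_iff
        cohom_cong[of "J.p_subgroup p" "restrict \<phi> (J.p_subgroup p)" \<phi>
          "\<lambda>x. act (inv\<^bsub>J\<^esub> j) (restrict \<phi> (J.p_subgroup p) x)" "\<lambda>x. act (inv\<^bsub>J\<^esub> j) (\<phi> x)"]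
      by simp
    then show "res \<phi> p \<in> fst (A p)"
      using H1_fixed_iff[OF Dp[OF p] restrict_crossed_hom[OF K[OF p] \<phi>]] p
      by (simp add: res_def A_def)
  qed (simp add: res_def)
  have inj: "inj_on F (fst (H1 J N act))"
  proof (rule inj_onI)
    fix c d assume "c \<in> fst (H1 J N act)" "d \<in> fst (H1 J N act)" and eq: "F c = F d"
    then obtain \<phi> \<psi> where \<phi>: "\<phi> \<in> crossed_homs J N act" "c = cohom_class J N act \<phi>"
      and \<psi>: "\<psi> \<in> crossed_homs J N act" "d = cohom_class J N act \<psi>"
      unfolding H1_carrier by blast
    have "\<forall>p\<in>D. cohom (J.p_subgroup p) \<phi> \<psi>"
      using eq res_eq_iff[OF \<phi>(1) \<psi>(1)] by (simp add: \<phi>(2) \<psi>(2) F_class[OF \<phi>(1)] F_class[OF \<psi>(1)])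
    then have "cohom (carrier J) \<phi> \<psi>"
      using \<phi>(1) \<psi>(1) crossed_homs_carrier_iff by (intro cohom_if_restrictions_cohom) (auto simp: D)
    then show "c = d"
      using cohom_class_carrier_eq_iff[OF \<phi>(1) \<psi>(1)] \<phi>(2) \<psi>(2) by blast
  qed
  have surj: "\<exists>c\<in>fst (H1 J N act). F c = t" if t: "t \<in> (\<Pi>\<^sub>E p\<in>D. fst (A p))" for t
  proof -
    have "\<exists>\<psi>\<in>crossed_homs (J\<lparr>carrier := J.p_subgroup p\<rparr>) N act.
        t p = cohom_class (J\<lparr>carrier := J.p_subgroup p\<rparr>) N act \<psi>" if "p \<in> D" for p
      using PiE_mem[OF t that] H1_carrier[of "J\<lparr>carrier := J.p_subgroup p\<rparr>"]
      by (auto simp: A_def H1_fixed_def)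
    then obtain \<psi> where \<psi>: "\<And>p. p \<in> D \<Longrightarrow> \<psi> p \<in> crossed_homs (J\<lparr>carrier := J.p_subgroup p\<rparr>) N act"
      "\<And>p. p \<in> D \<Longrightarrow> t p = cohom_class (J\<lparr>carrier := J.p_subgroup p\<rparr>) N act (\<psi> p)"
      by metis
    have inv: "cohom (J.p_subgroup p) (\<psi> p) (\<lambda>x. act (inv\<^bsub>J\<^esub> j) (\<psi> p x))"
      if "p \<in> D" "j \<in> J.p'_subgroup p" for p j
      using H1_fixed_iff[OF Dp[OF that(1)] \<psi>(1)[OF that(1)]] PiE_mem[OF t that(1)] \<psi>(2)[OF that(1)] that(2)
      by (simp add: A_def)
    have "cocycle (J.p_subgroup p) (\<psi> p)" if "p \<in> D" for p
      using \<psi>(1)[OF that] crossed_homs_iff[OF K[OF that]] by blast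
    then obtain f where f: "cocycle (carrier J) f" "\<And>p. p \<in> D \<Longrightarrow> cohom (J.p_subgroup p) f (\<psi> p)"
      using exists_cocycle_with_restrictions[OF finD Dp _ inv] by blast
    define \<phi> where "\<phi> = restrict f (carrier J)"
    have \<phi>: "\<phi> \<in> crossed_homs J N act"
      using f(1) cocycle_cong[OF J.subgroup_self, of \<phi> f] crossed_homs_carrier_iff
      by (simp add: \<phi>_def)
    have "res \<phi> p = t p" if p: "p \<in> D" for p
    proof -
      have "restrict \<phi> (J.p_subgroup p) k = f k" if "k \<in> J.p_subgroup p" for k
        using that subgroup.subset[OF K[OF p]] by (auto simp: \<phi>_def)
      then have "cohom (J.p_subgroup p) (restrict \<phi> (J.p_subgroup p)) (\<psi> p)
          \<longleftrightarrow> cohom (J.p_subgroup p) f (\<psi> p)"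
        by (intro cohom_cong) auto
      then have "cohom (J.p_subgroup p) (restrict \<phi> (J.p_subgroup p)) (\<psi> p)"
        using f(2)[OF p] by blast
      then show ?thesis
        using cohom_class_eq_iff[OF K[OF p] restrict_crossed_hom[OF K[OF p] \<phi>] \<psi>(1)[OF p]] \<psi>(2)[OF p] p
        by (simp add: res_def)
    qed
    moreover have "res \<phi> \<in> extensional D" "t \<in> extensional D"
      using t by (auto simp: res_def PiE_def)
    ultimately have "res \<phi> = t"
      by (intro extensionalityI) auto
    then show ?thesis
      using F_class[OF \<phi>] \<phi> unfolding H1_carrier by blast
  qed
  have "F ` fst (H1 J N act) = (\<Pi>\<^sub>E p\<in>D. fst (A p))"
  proof
    show "F ` fst (H1 J N act) \<subseteq> (\<Pi>\<^sub>E p\<in>D. fst (A p))"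
      unfolding H1_carrier by (intro image_subsetI, elim imageE) (simp only: F_class res_mem)
    show "(\<Pi>\<^sub>E p\<in>D. fst (A p)) \<subseteq> F ` fst (H1 J N act)"
      using surj by blast
  qed
  then have bij: "bij_betw F (fst (H1 J N act)) (\<Pi>\<^sub>E p\<in>D. fst (A p))"
    using inj by (simp add: bij_betw_def)
  have triv: "(\<lambda>k\<in>carrier J. \<one>) \<in> crossed_homs J N act"
    using act_id by (auto simp: crossed_homs_def)
  have "restrict (\<lambda>k\<in>carrier J. \<one>) (J.p_subgroup p) = (\<lambda>k\<in>J.p_subgroup p. \<one>)" if "p \<in> D" for p
    using subgroup.subset[OF K[OF that]] by (auto simp: fun_eq_iff subset_iff)
  then have "F (snd (H1 J N act)) = (\<lambda>p\<in>D. snd (A p))"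
    using F_class[OF triv] by (auto simp: H1_def A_def H1_fixed_def res_def intro!: restrict_ext)
  then have "pointed_iso F (H1 J N act) (pointed_prod D A)"
    using bij by (simp add: pointed_iso_def pointed_prod_def)
  then show ?thesis
    using F_class unfolding A_def res_def by blast
qed

end

theorem lemma1:
  fixes J :: "('j, 'x) monoid_scheme" and N :: "('n, 'y) monoid_scheme"
    and act :: "'j \<Rightarrow> 'n \<Rightarrow> 'n" and D :: "nat set"
  assumes "nilpotent_group J" and "finite (carrier J)"
    and "nilpotent_group N" and "finite (carrier N)"
    and "acts_by_automorphisms J N act"
    and "D = {p :: nat. Factorial_Ring.prime p \<and> p dvd order J \<and> p dvd order N}"
  shows "\<exists>F. (\<forall>\<phi>\<in>crossed_homs J N act.
              F (cohom_class J N act \<phi>) =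
                (\<lambda>p\<in>D. cohom_class (J\<lparr>carrier := sylow_subgroup J p\<rparr>) N act
                          (restrict \<phi> (sylow_subgroup J p)))) \<and>
            pointed_iso F (H1 J N act)
              (pointed_prod D (\<lambda>p. H1_fixed J N act (sylow_subgroup J p) (hall_complement_subgroup J p)))"
proof -
  have groups: "group J" "group N"
    using assms(1,3) by (simp_all add: nilpotent_group_def)
  interpret J: group J by (rule groups(1))
  interpret N: group N by (rule groups(2))
  interpret nilpotent_right_action J N act
  proof (intro nilpotent_right_action.intro nilpotent_action.intro aut_action.intro aut_action_axioms.intro
      finite_nilpotent_group.intro finite_nilpotent_group_axioms.intro groups assms(1-4))
    fix k assume k: "k \<in> carrier J"
    show "act (inv\<^bsub>J\<^esub> k) \<in> hom N N"
      using assms(5) k by (simp add: acts_by_automorphisms_def iso_def)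
    fix l n assume l: "l \<in> carrier J" and n: "n \<in> carrier N"
    have "act (inv\<^bsub>J\<^esub> l \<otimes>\<^bsub>J\<^esub> inv\<^bsub>J\<^esub> k) n = act (inv\<^bsub>J\<^esub> k) (act (inv\<^bsub>J\<^esub> l) n)"
      using assms(5) k l n by (simp add: acts_by_automorphisms_def)
    then show "act (inv\<^bsub>J\<^esub> (k \<otimes>\<^bsub>J\<^esub> l)) n = act (inv\<^bsub>J\<^esub> k) (act (inv\<^bsub>J\<^esub> l) n)"
      using k l by (simp add: J.inv_mult_group)
  next
    fix n assume "n \<in> carrier N"
    then show "act (inv\<^bsub>J\<^esub> \<one>\<^bsub>J\<^esub>) n = n"
      using assms(5) by (simp add: acts_by_automorphisms_def)
  qed
  have prime: "Factorial_Ring.prime p" if "p \<in> D" for p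
    using that assms(6) by blast
  have prod_eq: "pointed_prod D (\<lambda>p. H1_fixed J N act (sylow_subgroup J p) (hall_complement_subgroup J p))
      = pointed_prod D (\<lambda>p. H1_fixed J N act (J.p_subgroup p) (J.p'_subgroup p))"
    unfolding pointed_prod_def
    by (auto simp: J.sylow_subgroup_eq[OF prime] J.hall_complement_subgroup_eq[OF prime]
        intro!: PiE_cong restrict_ext)
  have res_eq: "(\<lambda>p\<in>D. cohom_class (J\<lparr>carrier := sylow_subgroup J p\<rparr>) N act (restrict \<phi> (sylow_subgroup J p)))
      = (\<lambda>p\<in>D. cohom_class (J\<lparr>carrier := J.p_subgroup p\<rparr>) N act (restrict \<phi> (J.p_subgroup p)))" for \<phi>
    by (auto simp: J.sylow_subgroup_eq[OF prime] intro!: restrict_ext)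
  show ?thesis
    unfolding prod_eq res_eq by (rule restriction_pointed_iso[OF assms(6)])
qed

end
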